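(* Let $L$ be a finite extension of $\mathbb Q_p$ with uniformizer $\pi_L$, $\theta\in\widehat\Delta$, and $a\in O_L$ with $a(a-1)\not\equiv 0\pmod{\pi_L}$. Then $M'(T,\theta,a)\equiv 0\pmod{\pi_L}$ (derivative with respect to $T$, congruence coefficientwise in $O_L[[T]]$) if and only if $a\equiv-1\pmod{\pi_L}$ and $\theta$ is odd.
   Context: Let $p\ge5$ be prime; $\zeta_{p^{n+1}}$ compatible primitive $p^{n+1}$-th roots of unity, $K_n=\mathbb Q_p(\zeta_{p^{n+1}})$, $\Gamma_n=\mathrm{Gal}(K_n/K_0)$, $\gamma_0\in\varprojlim\Gamma_n$ acting by $\zeta\mapsto\zeta^{1+p}$. For $a\in\mathbb Z_p^*$: $\omega(a)$ Teichmüller, $\langle a\rangle=a/\omega(a)$, $\gamma_n(a)\in\Gamma_n$: $\zeta_{p^{n+1}}\mapsto\zeta_{p^{n+1}}^{\langle a\rangle}$. $\widehat\Delta$ is the group of characters $\theta:(\mathbb Z/p)^*\cong\Delta\to\mu_{p-1}$ (powers of $\omega$), $\theta(k)$ for $p\nmid k$; $\theta$ is even if $\theta(-1)=1$ and odd if $\theta(-1)=-1$. $\Lambda_L=O_L[[T]]\cong\varprojlim O_L[\Gamma_n]$ with $T\leftrightarrow\gamma_0-1$. For $\theta\in\widehat\Delta$ and $a\in O_L$ with $a(a-1)\not\equiv0\pmod{\pi_L}$, $M_n(\theta,a)=\sum_{1\le k\le p^{n+1}-1,\,p\nmid k}\frac{a^k}{a^{p^{n+1}}-1}\theta(k)\omega^{-1}(k)\gamma_n(k)\in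 O_L[\Gamma_n]$; these form a compatible system under restriction, and $M(T,\theta,a)\in\Lambda_L$ denotes the corresponding power series. *)

theory Defs
  imports "HOL-Computational_Algebra.Formal_Power_Series"
begin

definition mult_set :: "'a::field \<Rightarrow> 'a set \<Rightarrow> 'a set" where
  "mult_set x OL = (\<lambda>y. x * y) ` OL"

text \<open>padic_field p OL pi: OL is the valuation ring of the (ambient, characteristic 0) field,
  a complete discrete valuation ring with uniformizer pi, fraction field the whole type,
  finite residue field of characteristic p.  These are exactly (up to isomorphism)
  the finite extensions L of Q_p with O_L = OL and pi_L = pi.\<close>
definition padic_field :: "nat \<Rightarrow> 'a::field_char_0 set \<Rightarrow> 'a \<Rightarrow> bool" where
  "padic_field p OL \<pi> \<longleftrightarrow>
     0 \<in> OL \<and> 1 \<in> OL \<and> (\<forall>x\<in>OL. \<forall>y\<in>OL. x + y \<in> OL \<and> x * y \<in> OL \<and> - x \<in> OL) \<and>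
     \<pi> \<in> OL \<and> \<pi> \<noteq> 0 \<and> inverse \<pi> \<notin> OL \<and>
     (\<forall>x. x \<noteq> 0 \<longrightarrow> (\<exists>n::int. \<exists>u. u \<in> OL \<and> inverse u \<in> OL \<and> x = \<pi> powi n * u)) \<and>
     of_nat p \<in> mult_set \<pi> OL \<and>
     (\<exists>S. finite S \<and> S \<subseteq> OL \<and> (\<forall>x\<in>OL. \<exists>s\<in>S. x - s \<in> mult_set \<pi> OL)) \<and>
     (\<forall>x::nat \<Rightarrow> 'a. (\<forall>n. x n \<in> OL \<and> x (Suc n) - x n \<in> mult_set (\<pi> ^ n) OL) \<longrightarrow>
        (\<exists>y\<in>OL. \<forall>n. y - x n \<in> mult_set (\<pi> ^ n) OL))"

definition teich :: "nat \<Rightarrow> 'a::field_char_0 set \<Rightarrow> 'a \<Rightarrow> int \<Rightarrow> 'a" where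
  "teich p OL \<pi> k = (THE w. w \<in> OL \<and> w ^ (p - 1) = 1 \<and> w - of_int k \<in> mult_set \<pi> OL)"

text \<open>gamma_n(k) = gamma_0^e, where (1+p)^e = <k> = k / omega(k) modulo p^(n+1), 0 <= e < p^n.\<close>
definition gamma_index :: "nat \<Rightarrow> 'a::field_char_0 set \<Rightarrow> 'a \<Rightarrow> nat \<Rightarrow> nat \<Rightarrow> nat" where
  "gamma_index p OL \<pi> n k = (THE e. e < p ^ n \<and>
      of_nat ((1 + p) ^ e) * teich p OL \<pi> (int k) - of_nat k \<in> mult_set (of_nat (p ^ (n + 1))) OL)"

text \<open>theta = omega^i; coefficient of gamma_0^e in M_n(theta,a).\<close>
definition Mn_coeff :: "nat \<Rightarrow> 'a::field_char_0 set \<Rightarrow> 'a \<Rightarrow> nat \<Rightarrow> 'a \<Rightarrow> nat \<Rightarrow> nat \<Rightarrow> 'a" where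
  "Mn_coeff p OL \<pi> i a n e =
     (\<Sum>k\<in>{k. 1 \<le> k \<and> k \<le> p ^ (n + 1) - 1 \<and> \<not> p dvd k \<and> gamma_index p OL \<pi> n k = e}.
        a ^ k / (a ^ (p ^ (n + 1)) - 1) * teich p OL \<pi> (int k) ^ i * inverse (teich p OL \<pi> (int k)))"

text \<open>Image of M_n in O_L[[T]]/((1+T)^(p^n)-1), via gamma_0 <-> 1+T.\<close>
definition Mn_fps :: "nat \<Rightarrow> 'a::field_char_0 set \<Rightarrow> 'a \<Rightarrow> nat \<Rightarrow> 'a \<Rightarrow> nat \<Rightarrow> 'a fps" where
  "Mn_fps p OL \<pi> i a n = (\<Sum>e<p ^ n. fps_const (Mn_coeff p OL \<pi> i a n e) * (1 + fps_X) ^ e)"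

definition iwasawa_M :: "nat \<Rightarrow> 'a::field_char_0 set \<Rightarrow> 'a \<Rightarrow> nat \<Rightarrow> 'a \<Rightarrow> 'a fps" where
  "iwasawa_M p OL \<pi> i a = (THE M. (\<forall>j. fps_nth M j \<in> OL) \<and>
      (\<forall>n. \<exists>Q. (\<forall>j. fps_nth Q j \<in> OL) \<and>
          M - Mn_fps p OL \<pi> i a n = ((1 + fps_X) ^ (p ^ n) - 1) * Q))"

end

theory Submission
  imports Defs "HOL-Number_Theory.Residues"
begin

text \<open>
  Modulo \<open>\<pi>\<close>, \<open>(1 + T)^(p^n) - 1\<close> is \<open>T^(p^n)\<close>, so applying \<open>(1 + T) d/dT\<close> to the \<open>n\<close>-th layer shows
  that \<open>M' \<equiv> 0\<close> forces the coefficient of \<open>\<gamma>\<^sub>0^e\<close> in \<open>M\<^sub>n\<close> to vanish modulo \<open>\<pi>\<close> whenever \<open>p\<close> does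
  not divide \<open>e\<close>. Up to the unit \<open>a^(p^N) - 1\<close>, \<open>N = n + 1\<close>, this coefficient is
  \<open>\<Sum>\<eta>. \<theta>(\<eta>) \<eta>\<inverse> a^{\<eta>u}\<close>, where \<open>u = (1 + p)^e\<close>, \<open>\<eta>\<close> runs through the \<open>(p - 1)\<close>-th roots of unity and
  \<open>{x}\<close> is the representative of \<open>x\<close> in \<open>[0, p^N)\<close>. If \<open>a \<equiv> -1\<close> and \<open>\<theta>\<close> is odd, the terms of \<open>\<eta>\<close> and
  \<open>-\<eta>\<close> cancel.

  Conversely, let \<open>a^M \<equiv> 1\<close>. The difference operator \<open>u \<mapsto> u + M t/\<eta>\<close> changes the terms of \<open>\<plusminus>\<eta>\<close> only
  if \<open>{\<eta>u}\<close> wraps around, that is if \<open>\<eta>u\<close> is congruent to one of \<open>0, -1, \<dots>, -M t\<close>. Apply these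
  operators for all \<open>\<eta>\<close> modulo \<open>\<plusminus>1\<close>, with generic multipliers \<open>t\<close>, at \<open>u = -z\<close>. Since \<open>\<eta> \<noteq> \<plusminus>1\<close> is
  irrational, for large \<open>z\<close> and \<open>N\<close> only the wrap of \<open>\<eta> = \<plusminus>1\<close> survives, and its vanishing says
  \<open>a^(2z) \<equiv> -\<theta>(-1)\<close>. Two values of \<open>z\<close> that differ by \<open>p\<close> give \<open>a^(2p) \<equiv> 1\<close>, hence \<open>a \<equiv> -1\<close>, and then
  \<open>\<theta>(-1) = -1\<close>.
\<close>

section \<open>Powers of \<open>1 + p\<close>\<close>

text \<open>A prime divides its inner binomial coefficients, and every inner term contains both
  \<open>x\<close> and \<open>y\<close>. Pulling out \<open>p * x * y\<close> keeps track of the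
  exact power of \<open>p\<close> when \<open>x\<close> itself is divisible by
  \<open>p\<close>.\<close>

lemma binomial_prime_expansion:
  fixes x y :: "'a::comm_ring_1"
  assumes "prime p"
  shows "(x + y) ^ p = x ^ p + y ^ p + of_nat p * (x * y *
           (\<Sum>k\<in>{1..<p}. of_nat ((p choose k) div p) * x ^ (k - 1) * y ^ (p - k - 1)))"
proof -
  have p1: "1 < p" using assms prime_gt_1_nat by auto
  have S: "{..p} = insert 0 (insert p {1..<p})" using p1 by auto
  have "(x + y) ^ p = (\<Sum>k\<le>p. of_nat (p choose k) * x ^ k * y ^ (p - k))"
    by (rule binomial_ring)
  also have "\<dots> = y ^ p + (x ^ p + (\<Sum>k\<in>{1..<p}. of_nat (p choose k) * x ^ k * y ^ (p - k)))"
    using p1 by (simp add: S)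
  also have "(\<Sum>k\<in>{1..<p}. of_nat (p choose k) * x ^ k * y ^ (p - k)) =
     (\<Sum>k\<in>{1..<p}. of_nat p * (x * y * (of_nat ((p choose k) div p) * x ^ (k - 1) * y ^ (p - k - 1))))"
  proof (rule sum.cong[OF refl])
    fix k assume k: "k \<in> {1..<p}"
    then have "p dvd (p choose k)" using assms by (intro dvd_choose_prime) auto
    then have "(p choose k) = p * ((p choose k) div p)" by simp
    then have "of_nat (p choose k) = of_nat p * (of_nat ((p choose k) div p) :: 'a)"
      by (metis of_nat_mult)
    moreover have "x ^ k = x * x ^ (k - 1)" using k by (cases k) auto
    moreover have "y ^ (p - k) = y * y ^ (p - k - 1)" using k
      by (metis atLeastLessThan_iff power_eq_if zero_less_diff less_numeral_extra(3))
    ultimately show "of_nat (p choose k) * x ^ k * y ^ (p - k) =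
      of_nat p * (x * y * (of_nat ((p choose k) div p) * x ^ (k - 1) * y ^ (p - k - 1)))"
      by (simp only: mult_ac)
  qed
  finally show ?thesis by (simp add: sum_distrib_left algebra_simps)
qed

text \<open>Raising to the power \<open>p\<close> moves the leading term from \<open>p^(n+1)\<close>
  to \<open>p^(n+2)\<close>. What remains has higher order; for \<open>y^p\<close> this uses
  \<open>p \<ge> 3\<close>, since \<open>y^3\<close> is already divisible by
  \<open>p^(n+3)\<close>.\<close>

lemma one_plus_prime_power:
  assumes "prime p" "odd p"
  shows "\<exists>c::int. (1 + int p) ^ (p ^ n) = 1 + int p ^ (n + 1) + int p ^ (n + 2) * c"
proof (induction n)
  case 0
  show ?case by (rule exI[of _ 0]) simp
next
  case (Suc n)
  then obtain c where c: "(1 + int p) ^ (p ^ n) = 1 + int p ^ (n + 1) + int p ^ (n + 2) * c" by blast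
  have p3: "3 \<le> p" using assms by (metis One_nat_def Suc_leI nat_less_le numeral_3_eq_3 odd_one
      One_nat_def even_numeral numeral_2_eq_2 prime_ge_2_nat)
  define d where "d = 1 + int p * c"
  define y where "y = int p ^ (n + 1) * d"
  define s where "s = (\<Sum>k\<in>{1..<p}. int ((p choose k) div p) * y ^ (k - 1) * 1 ^ (p - k - 1))"
  have e: "(1 + int p) ^ (p ^ Suc n) = (y + 1) ^ p"
  proof -
    have "(1 + int p) ^ (p ^ Suc n) = ((1 + int p) ^ (p ^ n)) ^ p"
      by (simp add: mult.commute flip: power_mult)
    also have "(1 + int p) ^ (p ^ n) = y + 1"
      by (simp add: c y_def d_def algebra_simps)
    finally show ?thesis .
  qed
  also have "\<dots> = y ^ p + 1 + int p * (y * s)"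
    using binomial_prime_expansion[OF assms(1), of y 1] by (simp add: s_def)
  \<comment> \<open>The term \<open>k = 1\<close> has coefficient
    \<open>(p choose 1) div p = 1\<close>; all others contain a factor \<open>y\<close>.\<close>
  also have "s = 1 + y * (\<Sum>k\<in>{2..<p}. int ((p choose k) div p) * y ^ (k - 2))"
  proof -
    have "{1..<p} = insert 1 {2..<p}" using p3 by auto
    moreover have "(\<Sum>k\<in>{2..<p}. int ((p choose k) div p) * y ^ (k - 1)) =
          (\<Sum>k\<in>{2..<p}. y * (int ((p choose k) div p) * y ^ (k - 2)))"
    proof (rule sum.cong[OF refl])
      fix k assume "k \<in> {2..<p}"
      then have "k - 1 = Suc (k - 2)" by auto
      then show "int ((p choose k) div p) * y ^ (k - 1) = y * (int ((p choose k) div p) * y ^ (k - 2))"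
        by simp
    qed
    ultimately show ?thesis using p3 unfolding s_def by (simp add: sum_distrib_left)
  qed
  finally obtain r where r: "(1 + int p) ^ (p ^ Suc n) = y ^ p + 1 + int p * (y * (1 + y * r))" by blast
  have "y ^ p = y ^ (p - 3) * y ^ 3" using p3 by (simp flip: power_add)
  also have "y ^ 3 = int p ^ (n + 3) * (int p ^ (2 * n) * d ^ 3)"
    by (simp add: y_def power_even_eq power_add power2_eq_square power3_eq_cube)
  finally have yp: "y ^ p = int p ^ (n + 3) * (y ^ (p - 3) * int p ^ (2 * n) * d ^ 3)"
    by (simp add: algebra_simps)
  have "(1 + int p) ^ (p ^ Suc n) = 1 + int p ^ (n + 2) + int p ^ (n + 3) *
     ((y ^ (p - 3) * int p ^ (2 * n) * d ^ 3) + c + d * (int p ^ n * d * r))"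
    unfolding r yp by (simp add: y_def d_def algebra_simps power_add power2_eq_square power3_eq_cube)
  then show ?case by (auto simp: eval_nat_numeral)
qed

text \<open>By induction \<open>e = p^n * f\<close>. Modulo \<open>p^(n+2)\<close> the power is
  \<open>1 + p^(n+1) * f\<close>, so one more factor \<open>p\<close> in the hypothesis forces
  \<open>p\<close> to divide \<open>f\<close>.\<close>

lemma one_plus_prime_power_dvd:
  assumes "prime p" "odd p" "int p ^ (n + 1) dvd (1 + int p) ^ e - 1"
  shows "p ^ n dvd e"
  using assms(3)
proof (induction n)
  case 0 then show ?case by simp
next
  case (Suc n)
  then have "int p ^ (n + 1) dvd (1 + int p) ^ e - 1"
    by (meson power_le_dvd le_SucI add_le_mono1 le_refl Suc_n_not_le_n nat_le_linear)
  then obtain f where f: "e = p ^ n * f" using Suc by auto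
  obtain c where c: "(1 + int p) ^ (p ^ n) = 1 + int p ^ (n + 1) + int p ^ (n + 2) * c"
    using one_plus_prime_power[OF assms(1,2)] by blast
  have *: "\<exists>r. (1 + int p ^ (n + 1) + int p ^ (n + 2) * c) ^ f = 1 + int p ^ (n + 1) * int f + int p ^ (n + 2) * r"
  proof (induction f)
    case 0 show ?case by (rule exI[of _ 0]) simp
  next
    case (Suc f)
    then obtain r where r: "(1 + int p ^ (n + 1) + int p ^ (n + 2) * c) ^ f = 1 + int p ^ (n + 1) * int f + int p ^ (n + 2) * r"
      by blast
    show ?case unfolding power_Suc r
      by (rule exI[of _ "c * (1 + int p ^ (n + 1) * int f + int p ^ (n + 2) * r)
          + r * (1 + int p ^ (n + 1)) + int p ^ n * int f"]) (simp add: algebra_simps power_add power2_eq_square)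
  qed
  then obtain r where r: "(1 + int p) ^ e = 1 + int p ^ (n + 1) * int f + int p ^ (n + 2) * r"
    by (auto simp: f power_mult c)
  have "int p ^ (n + 2) dvd int p ^ (n + 1) * int f + int p ^ (n + 2) * r"
    using Suc.prems by (simp add: r)
  then have "int p ^ (n + 2) dvd int p ^ (n + 1) * int f"
    using dvd_add_left_iff dvd_triv_left by blast
  then have "int p dvd int f" using assms(1) by (simp add: prime_gt_0_nat)
  then show ?case using f by (simp add: mult.commute[of p])
qed

text \<open>Counting: exponents below \<open>p^n\<close> give distinct powers modulo
  \<open>p^(n+1)\<close> by the previous lemma, and there are just \<open>p^n\<close> residues
  congruent to 1 modulo \<open>p\<close>.\<close>

lemma one_plus_prime_surj:
  fixes x :: int
  assumes "prime p" "odd p" "int p dvd x - 1"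
  shows "\<exists>e<p ^ n. int p ^ (n + 1) dvd (1 + int p) ^ e - x"
proof -
  have p0: "p > 1" using assms(1) prime_gt_1_nat by auto
  let ?q = "int p ^ (n + 1)"
  let ?A = "{..<p ^ n}" and ?B = "(\<lambda>j. 1 + int p * int j) ` {..<p ^ n}"
  let ?f = "\<lambda>e. (1 + int p) ^ e mod ?q"
  have q: "?q > 0" using p0 by simp
  have mem: "y mod ?q \<in> ?B" if "int p dvd y - 1" for y
  proof -
    have "y mod ?q - 1 = (y - 1) - ?q * (y div ?q)" by (simp add: minus_div_mult_eq_mod[symmetric] algebra_simps)
    moreover have "int p dvd ?q * (y div ?q)" by simp
    ultimately have "int p dvd y mod ?q - 1" using dvd_diff[OF that] by metis
    then obtain k where k: "y mod ?q = 1 + int p * k" by (metis dvd_def add.commute diff_add_cancel)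
    moreover have lo: "0 \<le> y mod ?q" and hi: "y mod ?q < ?q" using q by auto
    have "0 \<le> k"
    proof (rule ccontr)
      assume "\<not> 0 \<le> k"
      then have "int p * k \<le> int p * (-1)" using p0 by (intro mult_left_mono) auto
      then show False using k lo p0 by linarith
    qed
    moreover have "k < int p ^ n"
    proof (rule ccontr)
      assume "\<not> k < int p ^ n"
      then have "int p * int p ^ n \<le> int p * k" using p0 by (intro mult_left_mono) auto
      then show False using k hi by simp
    qed
    ultimately show ?thesis by (intro image_eqI[of _ _ "nat k"]) (auto simp: nat_less_iff)
  qed
  have inj: "inj_on ?f ?A"
  proof (rule inj_onI)
    have main: "e = e'" if "e \<le> e'" "e' < p ^ n" "?f e = ?f e'" for e e'
    proof -
      have "?q dvd (1 + int p) ^ e' - (1 + int p) ^ e"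
        using that(3) by (metis mod_eq_dvd_iff)
      also have "(1 + int p) ^ e' - (1 + int p) ^ e = (1 + int p) ^ e * ((1 + int p) ^ (e' - e) - 1)"
        using that(1) by (simp add: algebra_simps flip: power_add)
      finally have "?q dvd (1 + int p) ^ (e' - e) - 1"
      proof (rule coprime_dvd_mult_right_iff[THEN iffD1, rotated])
        have "coprime (int p) (1 + int p)" by (metis coprime_1_right coprime_iff_gcd_eq_1 gcd_add1 add.commute gcd.commute)
        then show "coprime ?q ((1 + int p) ^ e)" by (metis coprime_power_left_iff coprime_power_right_iff)
      qed
      then have "p ^ n dvd e' - e" by (rule one_plus_prime_power_dvd[OF assms(1,2)])
      then show ?thesis using that(1,2) by (metis dvd_imp_le diff_is_0_eq le_antisym less_imp_diff_less not_le zero_less_iff_neq_zero)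
    qed
    fix e e' assume "e \<in> ?A" "e' \<in> ?A" "?f e = ?f e'"
    then show "e = e'" using main[of e e'] main[of e' e] by (cases "e \<le> e'") auto
  qed
  have sub: "?f ` ?A \<subseteq> ?B"
  proof safe
    fix e :: nat
    have "int p dvd (1 + int p) ^ e - 1"
      using power_diff_1_eq[of "1 + int p" e] by simp
    then show "?f e \<in> ?B" by (rule mem)
  qed
  have "card ?B = p ^ n" using p0 by (subst card_image) (auto simp: inj_on_def)
  then have "?f ` ?A = ?B"
    by (intro card_subset_eq sub) (use inj in \<open>auto simp: card_image\<close>)
  then have "x mod ?q \<in> ?f ` ?A" using mem[OF assms(3)] by simp
  then obtain e where "e < p ^ n" "x mod ?q = ?f e" by auto
  then show ?thesis by (metis mod_eq_dvd_iff)
qed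

section \<open>Arithmetic of the valuation ring\<close>

lemma mult_setI: "y \<in> OL \<Longrightarrow> c * y \<in> mult_set c OL"
  by (auto simp: mult_set_def)

lemma mult_setE:
  assumes "x \<in> mult_set c OL" obtains y where "y \<in> OL" "x = c * y"
  using assms by (auto simp: mult_set_def)

locale padic =
  fixes p :: nat and OL :: "'a::field_char_0 set" and \<pi> :: 'a
  assumes prime: "prime p" and p_ge: "p \<ge> 5" and field: "padic_field p OL \<pi>"
begin

text \<open>\<open>P\<close> is the maximal ideal. Residues and \<open>gamma_index\<close> live
  modulo the ideals \<open>I N\<close>, whereas completeness is phrased with powers of
  \<open>\<pi>\<close>; the two filtrations are compared below.\<close>

abbreviation "P \<equiv> mult_set \<pi> OL"
abbreviation "I N \<equiv> mult_set (of_nat p ^ N) OL"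

lemma p_odd: "odd p" using prime p_ge prime_odd_nat by force

lemma p_gt: "p > 1" using p_ge by simp

lemma OL_0 [simp]: "0 \<in> OL" and OL_1 [simp]: "1 \<in> OL"
  and OL_add [simp]: "x \<in> OL \<Longrightarrow> y \<in> OL \<Longrightarrow> x + y \<in> OL"
  and OL_mult [simp]: "x \<in> OL \<Longrightarrow> y \<in> OL \<Longrightarrow> x * y \<in> OL"
  and OL_minus [simp]: "x \<in> OL \<Longrightarrow> - x \<in> OL"
  and OL_pi [simp]: "\<pi> \<in> OL"
  and pi_nonzero [simp]: "\<pi> \<noteq> 0"
  and inverse_pi: "inverse \<pi> \<notin> OL"
  and p_in_P: "of_nat p \<in> P"
  using field unfolding padic_field_def by blast+

lemma uniformizer_decomp:
  assumes "x \<noteq> 0" obtains n :: int and u where "u \<in> OL" "inverse u \<in> OL" "x = \<pi> powi n * u"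
  using field assms unfolding padic_field_def by blast

lemma finite_residues: "\<exists>S. finite S \<and> S \<subseteq> OL \<and> (\<forall>x\<in>OL. \<exists>s\<in>S. x - s \<in> P)"
  using field unfolding padic_field_def by blast

lemma complete:
  assumes "\<And>n. x n \<in> OL" "\<And>n. x (Suc n) - x n \<in> mult_set (\<pi> ^ n) OL"
  obtains y where "y \<in> OL" "\<And>n. y - x n \<in> mult_set (\<pi> ^ n) OL"
proof -
  have "\<forall>x::nat \<Rightarrow> 'a. (\<forall>n. x n \<in> OL \<and> x (Suc n) - x n \<in> mult_set (\<pi> ^ n) OL) \<longrightarrow>
        (\<exists>y\<in>OL. \<forall>n. y - x n \<in> mult_set (\<pi> ^ n) OL)"
    using field unfolding padic_field_def by blast
  then show ?thesis using assms that by blast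
qed

section \<open>Closure rules and congruences for principal ideals\<close>

lemma OL_diff [simp]: "x \<in> OL \<Longrightarrow> y \<in> OL \<Longrightarrow> x - y \<in> OL"
  using OL_add[of x "- y"] by simp

lemma OL_power [simp]: "x \<in> OL \<Longrightarrow> x ^ n \<in> OL"
  by (induction n) auto

lemma OL_sum [simp]: "(\<And>x. x \<in> A \<Longrightarrow> f x \<in> OL) \<Longrightarrow> sum f A \<in> OL"
  by (induction A rule: infinite_finite_induct) auto

lemma OL_of_nat [simp]: "of_nat n \<in> OL"
  by (induction n) auto

lemma OL_of_int [simp]: "of_int n \<in> OL"
  by (cases n rule: int_cases2) auto

lemma ms_0 [simp]: "0 \<in> mult_set c OL"
  using mult_setI[of 0 OL c] by simp

lemma ms_add: "x \<in> mult_set c OL \<Longrightarrow> y \<in> mult_set c OL \<Longrightarrow> x + y \<in> mult_set c OL"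
  by (elim mult_setE) (metis OL_add distrib_left mult_setI)

lemma ms_minus: "x \<in> mult_set c OL \<Longrightarrow> - x \<in> mult_set c OL"
  by (elim mult_setE) (metis OL_minus mult_minus_right mult_setI)

lemma ms_diff: "x \<in> mult_set c OL \<Longrightarrow> y \<in> mult_set c OL \<Longrightarrow> x - y \<in> mult_set c OL"
  using ms_add[of x c "- y"] ms_minus by simp

lemma ms_minus_iff: "- x \<in> mult_set c OL \<longleftrightarrow> x \<in> mult_set c OL"
  using ms_minus[of x] ms_minus[of "- x"] by auto

lemma ms_commute: "x - y \<in> mult_set c OL \<longleftrightarrow> y - x \<in> mult_set c OL"
  using ms_minus_iff[of "x - y"] by simp

lemma ms_multL: "r \<in> OL \<Longrightarrow> x \<in> mult_set c OL \<Longrightarrow> r * x \<in> mult_set c OL"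
  using mult_setI[OF OL_mult, of r _ c] by (elim mult_setE) (simp add: mult_ac)

lemma ms_multR: "x \<in> mult_set c OL \<Longrightarrow> r \<in> OL \<Longrightarrow> x * r \<in> mult_set c OL"
  using ms_multL[of r x c] by (simp add: mult.commute)

lemma ms_mult: "x \<in> mult_set c OL \<Longrightarrow> y \<in> mult_set d OL \<Longrightarrow> x * y \<in> mult_set (c * d) OL"
  using mult_setI[OF OL_mult, of _ _ "c * d"] by (elim mult_setE) (simp add: mult_ac)

lemma ms_sum: "(\<And>x. x \<in> A \<Longrightarrow> f x \<in> mult_set c OL) \<Longrightarrow> sum f A \<in> mult_set c OL"
  by (induction A rule: infinite_finite_induct) (auto intro: ms_add)

lemma ms_trans: "x - y \<in> mult_set c OL \<Longrightarrow> y - z \<in> mult_set c OL \<Longrightarrow> x - z \<in> mult_set c OL"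
  using ms_add[of "x - y" c "y - z"] by simp

lemma ms_mult_cong:
  assumes "x - x' \<in> mult_set c OL" "y - y' \<in> mult_set c OL" "x' \<in> OL" "y \<in> OL"
  shows "x * y - x' * y' \<in> mult_set c OL"
proof -
  have "x * y - x' * y' = (x - x') * y + x' * (y - y')" by (simp add: algebra_simps)
  then show ?thesis using assms by (simp add: ms_add ms_multL ms_multR)
qed

lemma ms_power_cong:
  assumes "x - x' \<in> mult_set c OL" "x \<in> OL" "x' \<in> OL"
  shows "x ^ n - x' ^ n \<in> mult_set c OL"
proof (induction n)
  case (Suc n)
  then show ?case using ms_mult_cong[OF assms(1) Suc] assms by simp
qed simp

lemma ms_subset: "c \<in> mult_set d OL \<Longrightarrow> mult_set c OL \<subseteq> mult_set d OL"
  by (auto elim!: mult_setE intro!: mult_setI OL_mult simp: mult.assoc)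

lemma ms_OL: "c \<in> OL \<Longrightarrow> x \<in> mult_set c OL \<Longrightarrow> x \<in> OL"
  by (auto elim!: mult_setE)

lemma P_OL: "x \<in> P \<Longrightarrow> x \<in> OL" by (rule ms_OL) auto

lemma pi_power_mono: "m \<le> n \<Longrightarrow> mult_set (\<pi> ^ n) OL \<subseteq> mult_set (\<pi> ^ m) OL"
  by (intro ms_subset) (metis OL_pi OL_power le_add_diff_inverse mult_setI power_add)

lemma I_mono: "m \<le> n \<Longrightarrow> I n \<subseteq> I m"
  by (intro ms_subset) (metis OL_of_nat OL_power le_add_diff_inverse mult_setI power_add)

section \<open>Units, and the traces of \<open>P\<close> and \<open>I N\<close> on the
  integers\<close>

lemma unit_OL:
  assumes "x \<in> OL" "x \<notin> P" shows "x \<noteq> 0" "inverse x \<in> OL"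
proof -
  show x0: "x \<noteq> 0" using assms(2) by auto
  from uniformizer_decomp[OF x0] obtain n u
    where u: "u \<in> OL" "inverse u \<in> OL" "x = \<pi> powi n * u" by blast
  have u0: "u \<noteq> 0" using u(3) x0 by auto
  consider "n \<ge> 1" | "n = 0" | "n \<le> -1" by linarith
  then show "inverse x \<in> OL"
  proof cases
    case 1
    then have "\<pi> powi n = \<pi> * \<pi> ^ nat (n - 1)"
      by (simp add: power_int_def Suc_nat_eq_nat_zadd1 flip: power_Suc)
    then have "x \<in> P" using u(1,3) by (simp add: mult.assoc mult_setI)
    then show ?thesis using assms by simp
  next
    case 2 then show ?thesis using u by simp
  next
    \<comment> \<open>A negative exponent would make \<open>inverse \<pi>\<close> the product of
      \<open>\<pi> powi n\<close>, which is \<open>x\<close> times a unit, and a nonnegative power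
      of \<open>\<pi>\<close>.\<close>
    case 3
    have "\<pi> powi n = x * inverse u" using u(3) u0 by simp
    then have *: "\<pi> powi n \<in> OL" using assms(1) u(2) by simp
    have "inverse \<pi> = \<pi> powi (- 1)" by simp
    also have "\<dots> = \<pi> powi n * \<pi> powi (- 1 - n)" by (subst power_int_add[symmetric]) auto
    also have "\<pi> powi (- 1 - n) = \<pi> ^ nat (- 1 - n)" using 3 by (simp add: power_int_def)
    finally have "inverse \<pi> \<in> OL" using * by simp
    then show ?thesis using inverse_pi by simp
  qed
qed

lemma one_notin_P: "1 \<notin> P"
proof
  assume "1 \<in> P"
  then obtain y where "y \<in> OL" "1 = \<pi> * y" by (rule mult_setE)
  then show False using inverse_pi by (metis inverse_unique)
qed

lemma P_prime:
  assumes "x \<in> OL" "y \<in> OL" "x * y \<in> P" shows "x \<in> P \<or> y \<in> P"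
proof (rule ccontr)
  assume "\<not> ?thesis"
  then have "x \<noteq> 0" "y \<noteq> 0" "inverse x * inverse y \<in> OL" using unit_OL assms by auto
  then have "inverse x * inverse y * (x * y) \<in> P" using assms(3) ms_multL by blast
  then show False using one_notin_P \<open>x \<noteq> 0\<close> \<open>y \<noteq> 0\<close> by (simp add: field_simps)
qed

lemma P_power: "x \<in> OL \<Longrightarrow> x ^ n \<in> P \<Longrightarrow> x \<in> P"
proof (induction n)
  case (Suc n)
  then show ?case using P_prime[of x "x ^ n"] by auto
qed (use one_notin_P in auto)

lemma of_int_P_iff: "of_int k \<in> P \<longleftrightarrow> int p dvd k"
proof
  assume "int p dvd k"
  then show "of_int k \<in> P" using p_in_P ms_multR by (auto simp: dvd_def)
next
  assume k: "of_int k \<in> P"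
  show "int p dvd k"
  proof (rule ccontr)
    assume "\<not> int p dvd k"
    \<comment> \<open>Bezout would then put 1 into \<open>P\<close>.\<close>
    then have "coprime k (int p)"
      using prime by (metis coprime_commute prime_imp_coprime prime_nat_int_transfer)
    then obtain u v where "k * u + int p * v = 1"
      by (metis bezout_int coprime_iff_gcd_eq_1 mult.commute)
    then have "(1::'a) = of_int k * of_int u + of_nat p * of_int v"
      by (metis of_int_1 of_int_add of_int_mult of_int_of_nat_eq)
    then have "(1::'a) \<in> P" using k p_in_P by (metis OL_of_int ms_add ms_multR)
    then show False using one_notin_P by simp
  qed
qed

lemma of_nat_P_iff: "of_nat k \<in> P \<longleftrightarrow> p dvd k"
  using of_int_P_iff[of "int k"] by simp

lemma of_int_I_iff: "of_int k \<in> I N \<longleftrightarrow> int p ^ N dvd k"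
proof
  assume "int p ^ N dvd k"
  then obtain c where "k = int p ^ N * c" by (auto simp: dvd_def)
  then show "of_int k \<in> I N" using mult_setI[of "of_int c" OL "of_nat p ^ N"] by simp
next
  show "of_int k \<in> I N \<Longrightarrow> int p ^ N dvd k"
  proof (induction N arbitrary: k)
    case (Suc N)
    then obtain y where y: "y \<in> OL" "of_int k = of_nat p ^ Suc N * y" by (auto elim: mult_setE)
    have "of_int k \<in> P" using y p_in_P ms_multR by (simp add: mult.assoc)
    then obtain c where c: "k = int p * c" using of_int_P_iff by auto
    then have "of_int c = of_nat p ^ N * y" using y(2) p_gt by simp
    then have "int p ^ N dvd c" using Suc.IH y(1) mult_setI by metis
    then show ?case using c by simp
  qed simp
qed

lemma I_P: "N > 0 \<Longrightarrow> I N \<subseteq> P"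
  using p_in_P by (intro ms_subset) (cases N; auto simp: ms_multR)

section \<open>Comparison of the filtrations by powers of \<open>p\<close> and of
  \<open>\<pi>\<close>\<close>

lemma p_decomp: "\<exists>e u. 0 < e \<and> u \<in> OL \<and> inverse u \<in> OL \<and> (of_nat p :: 'a) = \<pi> ^ e * u"
proof -
  have p0: "(of_nat p :: 'a) \<noteq> 0" using p_gt by simp
  from uniformizer_decomp[OF p0] obtain n u
    where u: "u \<in> OL" "inverse u \<in> OL" "of_nat p = \<pi> powi n * u" by blast
  have "n \<ge> 1"
  proof (rule ccontr)
    assume "\<not> n \<ge> 1"
    then have "inverse (\<pi> powi n) = \<pi> ^ nat (- n)" by (simp add: power_int_def power_inverse)
    then have "inverse (of_nat p) \<in> OL" using u by simp
    then have "inverse (of_nat p) * of_nat p \<in> P" using p_in_P ms_multL by blast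
    then show False using one_notin_P p0 by simp
  qed
  then show ?thesis using u by (intro exI[of _ "nat n"] exI[of _ u]) (auto simp: power_int_def)
qed

text \<open>With \<open>e\<close> the ramification index, \<open>\<pi>^(e * N)\<close> is
  \<open>p^N\<close> up to a unit.\<close>

lemma pi_power_sub_I: "\<exists>m\<ge>N. mult_set (\<pi> ^ m) OL \<subseteq> I N"
proof -
  obtain e u where eu: "0 < e" "u \<in> OL" "inverse u \<in> OL" "(of_nat p :: 'a) = \<pi> ^ e * u"
    using p_decomp by blast
  have u0: "u \<noteq> 0" using eu(4) p_gt by auto
  have "\<pi> ^ e = of_nat p * inverse u" using eu(4) u0 by simp
  then have "\<pi> ^ (e * N) = of_nat p ^ N * inverse u ^ N"
    by (simp add: power_mult power_mult_distrib)
  then have "\<pi> ^ (e * N) \<in> I N" using eu(3) by (metis OL_power mult_setI)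
  then show ?thesis using eu(1) by (intro exI[of _ "e * N"] conjI ms_subset) auto
qed

lemma I_sub_pi_power: "I N \<subseteq> mult_set (\<pi> ^ N) OL"
proof (intro ms_subset)
  show "of_nat p ^ N \<in> mult_set (\<pi> ^ N) OL"
  proof (induction N)
    case 0 then show ?case using mult_setI[of 1 OL 1] by simp
  next
    case (Suc N) then show ?case using ms_mult[OF p_in_P Suc] by simp
  qed
qed

lemma pi_power_Inter:
  assumes "\<And>n. x \<in> mult_set (\<pi> ^ n) OL" shows "x = 0"
proof (rule ccontr)
  assume "x \<noteq> 0"
  from uniformizer_decomp[OF this] obtain n u
    where u: "u \<in> OL" "inverse u \<in> OL" "x = \<pi> powi n * u" by blast
  have u0: "u \<noteq> 0" using u(3) \<open>x \<noteq> 0\<close> by auto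
  obtain y where y: "y \<in> OL" "x = \<pi> ^ Suc (nat n) * y" using assms by (meson mult_setE)
  have "\<pi> powi n * u * inverse u = \<pi> * \<pi> ^ nat n * y * inverse u" using y u(3) by simp
  then have *: "\<pi> powi n = \<pi> * \<pi> ^ nat n * (y * inverse u)" using u0 by (simp add: mult.assoc)
  show False
  proof (cases "n \<ge> 0")
    case True
    then have "\<pi> ^ nat n * 1 = \<pi> ^ nat n * (\<pi> * (y * inverse u))"
      using * by (simp add: power_int_def mult_ac)
    then have "1 = \<pi> * (y * inverse u)" by (subst (asm) mult_left_cancel) auto
    then show False using one_notin_P y(1) u(2) mult_setI[of "y * inverse u" OL \<pi>] by simp
  next
    case False
    then have "1 = \<pi> powi n * \<pi> ^ nat (- n)" by (simp add: power_int_def power_inverse)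
    also have "\<dots> = \<pi> * (y * inverse u * \<pi> ^ nat (- n))" using * False by simp
    finally show False using one_notin_P y(1) u(2) mult_setI[of "y * inverse u * \<pi> ^ nat (- n)" OL \<pi>] by simp
  qed
qed

lemma I_Inter: "(\<And>n. x \<in> I n) \<Longrightarrow> x = 0"
  using I_sub_pi_power pi_power_Inter by blast

text \<open>A nonzero element lies in only finitely many \<open>I N\<close>, so a finite set of them
  is avoided from a common level on. This supplies the large \<open>N\<close> of the isolation
  argument.\<close>

lemma eventually_notin_I:
  assumes "finite S" "0 \<notin> S"
  shows "\<exists>N0. \<forall>N\<ge>N0. \<forall>x\<in>S. x \<notin> I N"
proof -
  have "\<exists>N. x \<notin> I N" if "x \<in> S" for x using I_Inter assms that by metis
  then obtain f where f: "\<And>x. x \<in> S \<Longrightarrow> x \<notin> I (f x)" by metis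
  have "x \<notin> I N" if "x \<in> S" "N \<ge> Max (f ` S)" for x N
    using f[OF that(1)] I_mono[of "f x" N] that assms(1) by (meson Max_ge finite_imageI image_eqI in_mono order_trans)
  then show ?thesis by blast
qed

text \<open>Modulo \<open>p\<close>, \<open>(y - 1)^p\<close> equals \<open>y^p - 1\<close>; hence
  the residue field has no nontrivial roots of unity of \<open>p\<close>-power order.\<close>

lemma frobenius_P:
  assumes "x \<in> OL" "x ^ (p ^ n) - 1 \<in> P" shows "x - 1 \<in> P"
  using assms(2)
proof (induction n)
  case (Suc n)
  define y where "y = x ^ (p ^ n)"
  have y: "y \<in> OL" using assms(1) by (simp add: y_def)
  define s where "s = (\<Sum>k\<in>{1..<p}. of_nat ((p choose k) div p) * (y - 1) ^ (k - 1) * 1 ^ (p - k - 1))"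
  have "y ^ p = ((y - 1) + 1) ^ p" by simp
  also have "\<dots> = (y - 1) ^ p + 1 + of_nat p * ((y - 1) * s)"
    using binomial_prime_expansion[OF prime, of "y - 1" 1] by (simp add: s_def)
  finally have "(y - 1) ^ p = (y ^ p - 1) - of_nat p * ((y - 1) * s)" by (simp only: algebra_simps)
  moreover have "s \<in> OL" using y by (auto simp: s_def)
  moreover have "y ^ p - 1 \<in> P" using Suc.prems unfolding y_def power_mult[symmetric] by (simp only: power_Suc2)
  ultimately have "(y - 1) ^ p \<in> P" using y
    by (simp add: ms_diff ms_multR p_in_P)
  then have "y - 1 \<in> P" using y P_power[of "y - 1" p] by simp
  then show ?case using Suc.IH y_def by simp
qed simp

text \<open>Pigeonhole on the powers of \<open>x\<close> in the finite residue field.\<close>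

lemma power_eq_one_residue:
  assumes "x \<in> OL" "x \<notin> P" shows "\<exists>m>0. x ^ m - 1 \<in> P"
proof -
  obtain S where S: "finite S" "S \<subseteq> OL" "\<forall>x\<in>OL. \<exists>s\<in>S. x - s \<in> P" using finite_residues by blast
  have "\<forall>n. \<exists>s. s \<in> S \<and> x ^ n - s \<in> P" using S(3) OL_power[OF assms(1)] by blast
  then obtain f where f: "\<And>n::nat. f n \<in> S" "\<And>n. x ^ n - f n \<in> P" by metis
  have "finite (range f)" using finite_subset[of "range f" S] f(1) S(1) by blast
  then have "\<not> inj f" using finite_imageD[of f UNIV] by auto
  then obtain i j where "i \<noteq> j" "f i = f j" by (auto simp: inj_def)
  then obtain i j where ij: "i < j" "f i = f j" by (metis linorder_neqE_nat)
  have "x ^ j - x ^ i \<in> P" using ms_diff[OF f(2)[of j] f(2)[of i]] ij(2) by simp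
  moreover have "x ^ j - x ^ i = x ^ i * (x ^ (j - i) - 1)"
    using ij(1) by (simp add: algebra_simps flip: power_add)
  ultimately have "x ^ i \<in> P \<or> x ^ (j - i) - 1 \<in> P" using P_prime[of "x ^ i" "x ^ (j - i) - 1"] assms(1) by simp
  then have "x ^ (j - i) - 1 \<in> P" using P_power[OF assms(1), of i] assms(2) by blast
  then show ?thesis using ij(1) by (intro exI[of _ "j - i"]) simp
qed

end

section \<open>Teichmueller representatives and residues\<close>

context padic
begin

abbreviation "\<omega> \<equiv> teich p OL \<pi>"

lemma root_of_unity_notin_P:
  assumes "w ^ (p - 1) = 1" shows "w \<notin> P"
proof
  assume "w \<in> P"
  then have "w * w ^ (p - 2) \<in> P" by (intro ms_multR OL_power P_OL)
  moreover have "w * w ^ (p - 2) = w ^ (p - 1)" using p_ge by (cases p; cases "p - 1") auto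
  ultimately show False using assms one_notin_P by simp
qed

lemma root_of_unity_inverse:
  fixes w :: 'a
  assumes "w ^ (p - 1) = 1" shows "inverse w = w ^ (p - 2)"
proof -
  have "w * w ^ (p - 2) = w ^ (p - 1)" using p_ge by (cases p; cases "p - 1") auto
  then show ?thesis using assms inverse_unique[of w "w ^ (p - 2)"] by simp
qed

text \<open>The quotient \<open>r\<close> is congruent to 1, so the geometric sum of its powers
  below \<open>p - 1\<close> is congruent to \<open>p - 1\<close>, hence nonzero; its product with
  \<open>r - 1\<close> is \<open>r^(p - 1) - 1 = 0\<close>.\<close>

lemma root_of_unity_eqI:
  assumes "w \<in> OL" "w ^ (p - 1) = 1" "w' \<in> OL" "w' ^ (p - 1) = 1" "w - w' \<in> P"
  shows "w = w'"
proof -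
  have w': "inverse w' \<in> OL" "w' \<noteq> 0" using unit_OL[of w'] root_of_unity_notin_P assms by auto
  define r where "r = w * inverse w'"
  have r: "r \<in> OL" "r ^ (p - 1) = 1" using assms w' by (auto simp: r_def power_mult_distrib power_inverse)
  have "r - 1 = (w - w') * inverse w'" using w' by (simp add: r_def field_simps)
  then have rP: "r - 1 \<in> P" using assms w' by (simp add: ms_multR)
  have "(\<Sum>i<p - 1. r ^ i) - (\<Sum>i<p - 1. 1) \<in> P"
    unfolding sum_subtractf[symmetric] using ms_power_cong[OF rP] r by (auto intro: ms_sum)
  moreover have "of_nat (p - 1) \<notin> P" using p_gt by (subst of_nat_P_iff) (simp add: nat_dvd_not_less)
  ultimately have "(\<Sum>i<p - 1. r ^ i) \<noteq> 0" using ms_minus_iff[of "of_nat (p - 1)" \<pi>] by auto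
  moreover have "(r - 1) * (\<Sum>i<p - 1. r ^ i) = 0" using power_diff_1_eq[of r "p - 1"] r by simp
  ultimately have "r = 1" by simp
  then show ?thesis using w' by (simp add: r_def field_simps)
qed

lemma teich_eqI:
  assumes "w \<in> OL" "w ^ (p - 1) = 1" "w - of_int k \<in> P"
  shows "\<omega> k = w"
  unfolding teich_def
proof (rule the_equality)
  fix v assume "v \<in> OL \<and> v ^ (p - 1) = 1 \<and> v - of_int k \<in> P"
  moreover from this have "v - w \<in> P" using ms_diff[OF _ assms(3), of "v - of_int k"] by simp
  ultimately show "v = w" using root_of_unity_eqI assms by blast
qed (use assms in auto)

text \<open>The representative is the limit of \<open>k^(p^n)\<close>; Euler's theorem modulo
  \<open>p^(n+1)\<close> makes the sequence converge. The last conjunct records that the limit lies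
  in the closure of the integers.\<close>

lemma teich_exists:
  assumes "\<not> p dvd k"
  shows "\<exists>w\<in>OL. w ^ (p - 1) = 1 \<and> w - of_nat k \<in> P \<and> (\<forall>N. \<exists>c::int. w - of_int c \<in> I N)"
proof -
  have cop: "coprime k (p ^ N)" for N
    using assms prime by (metis coprime_commute coprime_power_right_iff prime_imp_coprime)
  have euler: "int p ^ Suc n dvd int k ^ (p ^ n * (p - 1)) - 1" for n
  proof -
    have "[k ^ totient (p ^ Suc n) = 1] (mod p ^ Suc n)" by (rule euler_theorem[OF cop])
    then have "[int k ^ totient (p ^ Suc n) = 1] (mod int p ^ Suc n)"
      by (metis cong_int_iff of_nat_1 of_nat_power)
    then show ?thesis using totient_prime_power_Suc[OF prime, of n]
      by (simp add: cong_iff_dvd_diff del: power_Suc)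
  qed
  define x :: "nat \<Rightarrow> 'a" where "x = (\<lambda>n. of_nat k ^ (p ^ n))"
  have x_OL: "x n \<in> OL" for n by (simp add: x_def)
  have dI: "x (Suc n) - x n \<in> I (Suc n)" for n
  proof -
    have e: "p ^ Suc n = p ^ n * (p - 1) + p ^ n" using p_gt by (cases p) auto
    have "int k ^ (p ^ Suc n) - int k ^ (p ^ n) = (int k ^ (p ^ n * (p - 1)) - 1) * int k ^ (p ^ n)"
      unfolding e power_add by (simp add: algebra_simps)
    then have "int p ^ Suc n dvd int k ^ (p ^ Suc n) - int k ^ (p ^ n)"
      using euler by (metis dvd_mult2)
    then show ?thesis unfolding of_int_I_iff[symmetric] by (simp add: x_def)
  qed
  \<comment> \<open>Completeness only gives closeness in powers of \<open>\<pi>\<close>. The sharper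
    bound in powers of \<open>p\<close> is regained afterwards by comparison with a late
    \<open>x m\<close>.\<close>
  have "x (Suc n) - x n \<in> mult_set (\<pi> ^ n) OL" for n
    using dI[of n] I_sub_pi_power[of "Suc n"] pi_power_mono[of n "Suc n"] by auto
  then obtain w where w: "w \<in> OL" "\<And>n. w - x n \<in> mult_set (\<pi> ^ n) OL"
    using complete[of x] x_OL by blast
  have tail: "x (n + j) - x n \<in> I (Suc n)" for n j
  proof (induction j)
    case (Suc j)
    have "x (Suc (n + j)) - x (n + j) \<in> I (Suc n)" using dI[of "n + j"] I_mono[of "Suc n" "Suc (n + j)"] by auto
    then show ?case using Suc ms_trans by (metis add_Suc_right)
  qed simp
  have wI: "w - x n \<in> I (Suc n)" for n
  proof -
    obtain m where m: "m \<ge> Suc n" "mult_set (\<pi> ^ m) OL \<subseteq> I (Suc n)" using pi_power_sub_I by blast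
    have "x m - x n \<in> I (Suc n)" using tail[of n "m - n"] m(1) by simp
    moreover have "w - x m \<in> I (Suc n)" using w(2)[of m] m(2) by blast
    ultimately show ?thesis using ms_trans by blast
  qed
  have "w ^ (p - 1) - 1 \<in> I n" for n
  proof -
    have "w ^ (p - 1) - x n ^ (p - 1) \<in> I (Suc n)" using ms_power_cong[OF wI] w(1) x_OL by blast
    moreover have "x n ^ (p - 1) - 1 \<in> I (Suc n)"
      using euler[of n] unfolding of_int_I_iff[symmetric] by (simp add: x_def flip: power_mult)
    ultimately have "w ^ (p - 1) - 1 \<in> I (Suc n)" using ms_trans by blast
    then show ?thesis using I_mono[of n "Suc n"] by auto
  qed
  then have "w ^ (p - 1) - 1 = 0" by (rule I_Inter)
  then have 1: "w ^ (p - 1) = 1" by simp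
  have 2: "w - of_nat k \<in> P" using wI[of 0] I_P[of "Suc 0"] by (auto simp: x_def)
  have 3: "\<exists>c::int. w - of_int c \<in> I N" for N
  proof -
    have "w - of_int (int k ^ (p ^ N)) \<in> I N" using wI[of N] I_mono[of N "Suc N"] by (auto simp: x_def)
    then show ?thesis by blast
  qed
  show ?thesis using w(1) 1 2 3 by blast
qed

section \<open>The copy of the \<open>p\<close>-adic integers inside \<open>OL\<close>, as closure
  of the integers\<close>

definition Zp :: "'a set" where
  "Zp = {x \<in> OL. \<forall>N. \<exists>c::int. x - of_int c \<in> I N}"

lemma teich_OL: "\<not> p dvd k \<Longrightarrow> \<omega> (int k) \<in> OL"
  and teich_power: "\<not> p dvd k \<Longrightarrow> \<omega> (int k) ^ (p - 1) = 1"
  and teich_cong: "\<not> p dvd k \<Longrightarrow> \<omega> (int k) - of_nat k \<in> P"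
  and teich_Zp: "\<not> p dvd k \<Longrightarrow> \<omega> (int k) \<in> Zp"
  using teich_exists[of k] teich_eqI[of _ "int k"] by (auto simp: Zp_def)

lemma teich_inverse: "\<not> p dvd k \<Longrightarrow> inverse (\<omega> (int k)) = \<omega> (int k) ^ (p - 2)"
  using root_of_unity_inverse teich_power by blast

lemma teich_nonzero: "\<not> p dvd k \<Longrightarrow> \<omega> (int k) \<noteq> 0"
  using root_of_unity_notin_P[OF teich_power, of k] by auto

lemma teich_1: "\<omega> 1 = 1"
  by (rule teich_eqI) auto

lemma teich_minus_1: "\<omega> (-1) = -1"
  using p_odd by (intro teich_eqI) auto

lemma teich_minus:
  assumes "0 < k" "k < p" shows "\<omega> (int (p - k)) = - \<omega> (int k)"
proof (rule teich_eqI)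
  have k: "\<not> p dvd k" using assms by (simp add: nat_dvd_not_less)
  show "- \<omega> (int k) \<in> OL" using teich_OL[OF k] by simp
  show "(- \<omega> (int k)) ^ (p - 1) = 1" using teich_power[OF k] p_odd by simp
  have "- \<omega> (int k) - of_int (int (p - k)) = - (\<omega> (int k) - of_nat k) - of_nat p"
    using assms by (simp add: of_nat_diff)
  then show "- \<omega> (int k) - of_int (int (p - k)) \<in> P"
    using teich_cong[OF k] p_in_P by (metis ms_diff ms_minus)
qed

lemma teich_inj:
  assumes "\<not> p dvd k" "\<not> p dvd l" "\<omega> (int k) = \<omega> (int l)"
  shows "[k = l] (mod p)"
proof -
  have "of_nat k - of_nat l \<in> P" using ms_diff[OF teich_cong[OF assms(2)] teich_cong[OF assms(1)]] assms(3) by simp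
  then have "of_int (int k - int l) \<in> P" by simp
  then show ?thesis unfolding of_int_P_iff by (metis cong_iff_dvd_diff cong_int_iff)
qed

lemma Zp_OL: "x \<in> Zp \<Longrightarrow> x \<in> OL" by (simp add: Zp_def)

lemma Zp_approx:
  assumes "x \<in> Zp" obtains c :: int where "x - of_int c \<in> I N"
  using assms unfolding Zp_def by blast

lemma Zp_of_int [simp]: "of_int k \<in> Zp"
proof -
  have "of_int k - of_int k \<in> I N" for N by (simp only: diff_self ms_0)
  then show ?thesis unfolding Zp_def using OL_of_int by blast
qed

lemma Zp_of_nat [simp]: "of_nat k \<in> Zp"
  using Zp_of_int[of "int k"] by simp

lemma Zp_add [simp]: assumes "x \<in> Zp" "y \<in> Zp" shows "x + y \<in> Zp"
proof -
  have "\<exists>c::int. x + y - of_int c \<in> I N" for N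
  proof -
    obtain c d :: int where "x - of_int c \<in> I N" "y - of_int d \<in> I N"
      using assms Zp_approx by metis
    from ms_add[OF this] show ?thesis by (intro exI[of _ "c + d"]) (simp add: algebra_simps)
  qed
  then show ?thesis using assms by (simp add: Zp_def)
qed

lemma Zp_mult [simp]: assumes "x \<in> Zp" "y \<in> Zp" shows "x * y \<in> Zp"
proof -
  have "\<exists>c::int. x * y - of_int c \<in> I N" for N
  proof -
    obtain c d :: int where "x - of_int c \<in> I N" "y - of_int d \<in> I N"
      using assms Zp_approx by metis
    from ms_mult_cong[OF this] assms show ?thesis by (intro exI[of _ "c * d"]) (simp add: Zp_def)
  qed
  then show ?thesis using assms by (simp add: Zp_def)
qed

lemma Zp_0 [simp]: "0 \<in> Zp" and Zp_1 [simp]: "1 \<in> Zp"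
  using Zp_of_int[of 0] Zp_of_int[of 1] by auto

lemma Zp_minus [simp]: "x \<in> Zp \<Longrightarrow> - x \<in> Zp"
  using Zp_mult[OF Zp_of_int[of "-1"], of x] by simp

lemma Zp_power [simp]: "x \<in> Zp \<Longrightarrow> x ^ n \<in> Zp"
  by (induction n) auto

lemma Zp_sum [simp]: "(\<And>x. x \<in> A \<Longrightarrow> f x \<in> Zp) \<Longrightarrow> sum f A \<in> Zp"
  by (induction A rule: infinite_finite_induct) auto

lemma teich_inverse_Zp: "\<not> p dvd k \<Longrightarrow> inverse (\<omega> (int k)) \<in> Zp"
  by (simp add: teich_inverse teich_Zp)

section \<open>Representatives of \<open>p\<close>-adic integers in \<open>[0, p^N)\<close>\<close>

definition res :: "nat \<Rightarrow> 'a \<Rightarrow> nat" where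
  "res N x = (THE r. r < p ^ N \<and> x - of_nat r \<in> I N)"

lemma res_eqI:
  assumes "r < p ^ N" "x - of_nat r \<in> I N" shows "res N x = r"
  unfolding res_def
proof (rule the_equality)
  fix s assume s: "s < p ^ N \<and> x - of_nat s \<in> I N"
  then have "of_int (int s - int r) \<in> I N" using ms_diff[OF assms(2), of "x - of_nat s"] by simp
  then have "[int s = int r] (mod int (p ^ N))" unfolding of_int_I_iff by (simp add: cong_iff_dvd_diff)
  then have "[s = r] (mod p ^ N)" unfolding cong_int_iff .
  then show "s = r" using s assms(1) by (simp add: cong_less_modulus_unique_nat)
qed (use assms in auto)

lemma res_props:
  assumes "x \<in> Zp"
  shows res_less: "res N x < p ^ N" and res_cong: "x - of_nat (res N x) \<in> I N"
proof -
  obtain c :: int where c: "x - of_int c \<in> I N" using assms by (rule Zp_approx)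
  define r where "r = nat (c mod int (p ^ N))"
  have r: "int r = c mod int (p ^ N)" using p_gt by (simp add: r_def)
  have "r < p ^ N" using p_gt unfolding r_def by (simp add: nat_less_iff)
  moreover have "of_int (c - int r) \<in> I N" unfolding of_int_I_iff r by (simp add: minus_mod_eq_mult_div)
  then have "x - of_nat r \<in> I N" using ms_add[OF c, of "of_int (c - int r)"] by simp
  ultimately have "res N x < p ^ N \<and> x - of_nat (res N x) \<in> I N" using res_eqI by simp
  then show "res N x < p ^ N" "x - of_nat (res N x) \<in> I N" by auto
qed

lemma res_add:
  assumes "x \<in> Zp" "res N x + c < p ^ N" shows "res N (x + of_nat c) = res N x + c"
  using res_cong[OF assms(1), of N] assms(2) by (intro res_eqI) auto

lemma res_minus:
  assumes "x \<in> Zp" "res N x \<noteq> 0" shows "res N (- x) = p ^ N - res N x"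
proof (rule res_eqI)
  have 1: "of_nat p ^ N \<in> I N" using mult_setI[OF OL_1, of "of_nat p ^ N"] by (simp only: mult_1_right)
  show "p ^ N - res N x < p ^ N" using assms p_gt by simp
  have "- x - of_nat (p ^ N - res N x) = - (x - of_nat (res N x)) - of_nat p ^ N"
    using res_less[OF assms(1), of N] by (simp add: of_nat_diff)
  then show "- x - of_nat (p ^ N - res N x) \<in> I N"
    using ms_diff[OF ms_minus[OF res_cong[OF assms(1)]] 1] by (simp only:)
qed

lemma res_eq_0_iff: "x \<in> Zp \<Longrightarrow> res N x = 0 \<longleftrightarrow> x \<in> I N"
  using res_cong[of x N] res_eqI[of 0 N x] p_gt by auto

section \<open>The discrete logarithm to the base \<open>1 + p\<close>\<close>

lemma gamma_index_exists:
  assumes "\<not> p dvd k"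
  shows "\<exists>e<p ^ n. of_nat ((1 + p) ^ e) * \<omega> (int k) - of_nat k \<in> I (n + 1)"
proof -
  let ?w = "\<omega> (int k)"
  \<comment> \<open>\<open>int k * c\<close> is an integer approximation of
    \<open>k / \<omega>(k)\<close> modulo \<open>p^(n+1)\<close>; it is congruent to 1 modulo
    \<open>p\<close>, hence to a power of \<open>1 + p\<close>.\<close>
  obtain c :: int where c: "inverse ?w - of_int c \<in> I (n + 1)"
    using teich_inverse_Zp[OF assms] by (rule Zp_approx)
  have w: "?w \<in> OL" "inverse ?w \<in> OL" "?w \<noteq> 0"
    using teich_OL teich_inverse_Zp Zp_OL teich_nonzero assms by auto
  have 1: "1 - ?w * of_int c \<in> I (n + 1)"
    using ms_multL[OF w(1) c] by (simp only: right_diff_distrib right_inverse[OF w(3)])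
  then have "1 - ?w * of_int c \<in> P" using I_P[of "n + 1"] by auto
  moreover have "?w * of_int c - of_nat k * of_int c \<in> P"
    using ms_multR[OF teich_cong[OF assms], of "of_int c"] by (simp add: algebra_simps)
  ultimately have "1 - of_nat k * of_int c \<in> P" by (rule ms_trans)
  then have "of_int (int k * c - 1) \<in> P" using ms_commute by simp
  then have "int p dvd int k * c - 1" unfolding of_int_P_iff .
  from one_plus_prime_surj[OF prime p_odd this, of n] obtain e
    where e: "e < p ^ n" "int p ^ (n + 1) dvd (1 + int p) ^ e - int k * c" by blast
  have "of_int ((1 + int p) ^ e - int k * c) \<in> I (n + 1)" unfolding of_int_I_iff by (rule e(2))
  then have "(of_int ((1 + int p) ^ e - int k * c)) * ?w \<in> I (n + 1)" using w(1) by (rule ms_multR)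
  then have "of_nat ((1 + p) ^ e) * ?w - of_nat k * of_int c * ?w \<in> I (n + 1)"
    by (simp add: algebra_simps)
  moreover have "of_nat k * of_int c * ?w - of_nat k \<in> I (n + 1)"
    using ms_multL[OF OL_of_nat ms_minus[OF 1], of k] by (simp add: algebra_simps)
  ultimately show ?thesis using e(1) ms_trans by blast
qed

text \<open>This holds because \<open>1 + p\<close> has order exactly \<open>p^n\<close> modulo
  \<open>p^(n+1)\<close>.\<close>

lemma one_plus_p_cong_iff:
  "of_nat ((1 + p) ^ e) - of_nat ((1 + p) ^ e') \<in> I (n + 1) \<longleftrightarrow> [e = e'] (mod p ^ n)"
proof -
  have main: "of_nat ((1 + p) ^ e) - of_nat ((1 + p) ^ e') \<in> I (n + 1) \<longleftrightarrow> [e = e'] (mod p ^ n)"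
    if "e' \<le> e" for e e'
  proof -
    have "(1 + int p) ^ e - (1 + int p) ^ e' = (1 + int p) ^ e' * ((1 + int p) ^ (e - e') - 1)"
      using that by (simp add: algebra_simps flip: power_add)
    moreover have "coprime (int p) (1 + int p)" by (metis coprime_1_right coprime_iff_gcd_eq_1 gcd_add1 add.commute gcd.commute)
    then have "coprime (int p ^ (n + 1)) ((1 + int p) ^ e')" by (metis coprime_power_left_iff coprime_power_right_iff)
    ultimately have 1: "int p ^ (n + 1) dvd (1 + int p) ^ e - (1 + int p) ^ e' \<longleftrightarrow>
        int p ^ (n + 1) dvd (1 + int p) ^ (e - e') - 1"
      by (simp add: coprime_dvd_mult_right_iff)
    have 2: "int p ^ (n + 1) dvd (1 + int p) ^ f - 1 \<longleftrightarrow> p ^ n dvd f" for f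
    proof
      assume "p ^ n dvd f"
      then obtain g where g: "f = p ^ n * g" by auto
      obtain c where c: "(1 + int p) ^ (p ^ n) = 1 + int p ^ (n + 1) + int p ^ (n + 2) * c"
        using one_plus_prime_power[OF prime p_odd] by blast
      have "(1 + int p) ^ (p ^ n) - 1 = int p ^ (n + 1) * (1 + int p * c)"
        unfolding c by (simp add: algebra_simps)
      moreover have "(1 + int p) ^ (p ^ n) - 1 dvd ((1 + int p) ^ (p ^ n)) ^ g - 1"
        using power_diff_1_eq[of "(1 + int p) ^ (p ^ n)" g] by simp
      ultimately show "int p ^ (n + 1) dvd (1 + int p) ^ f - 1"
        by (metis dvd_trans dvd_triv_left g power_mult)
    qed (rule one_plus_prime_power_dvd[OF prime p_odd])
    have "of_nat ((1 + p) ^ e) - of_nat ((1 + p) ^ e') = (of_int ((1 + int p) ^ e - (1 + int p) ^ e') :: 'a)"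
      by simp
    then have "of_nat ((1 + p) ^ e) - of_nat ((1 + p) ^ e') \<in> I (n + 1) \<longleftrightarrow> p ^ n dvd e - e'"
      by (simp only: of_int_I_iff 1 2)
    also have "\<dots> \<longleftrightarrow> [e = e'] (mod p ^ n)" using that by (simp add: cong_altdef_nat)
    finally show ?thesis .
  qed
  show ?thesis
  proof (cases "e' \<le> e")
    case True then show ?thesis by (rule main)
  next
    case False
    then show ?thesis using main[of e e'] ms_commute cong_sym_eq by (metis nat_le_linear)
  qed
qed

lemma gamma_index_unique:
  assumes "\<not> p dvd k" "of_nat ((1 + p) ^ e) * \<omega> (int k) - of_nat k \<in> I (n + 1)"
    "of_nat ((1 + p) ^ e') * \<omega> (int k) - of_nat k \<in> I (n + 1)"
  shows "[e = e'] (mod p ^ n)"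
proof -
  let ?w = "\<omega> (int k)"
  have w: "?w \<noteq> 0" "inverse ?w \<in> OL" using teich_nonzero teich_inverse_Zp Zp_OL assms(1) by auto
  have "of_nat ((1 + p) ^ e) * ?w - of_nat ((1 + p) ^ e') * ?w \<in> I (n + 1)"
    using ms_diff[OF assms(2,3)] by simp
  from ms_multR[OF this w(2)] have "of_nat ((1 + p) ^ e) - of_nat ((1 + p) ^ e') \<in> I (n + 1)"
    by (simp only: left_diff_distrib mult.assoc right_inverse[OF w(1)] mult_1_right)
  then show ?thesis unfolding one_plus_p_cong_iff .
qed

lemma gamma_index_props:
  assumes "\<not> p dvd k"
  shows gamma_index_less: "gamma_index p OL \<pi> n k < p ^ n"
    and gamma_index_cong: "of_nat ((1 + p) ^ gamma_index p OL \<pi> n k) * \<omega> (int k) - of_nat k \<in> I (n + 1)"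
proof -
  have "\<exists>!e. e < p ^ n \<and> of_nat ((1 + p) ^ e) * \<omega> (int k) - of_nat k \<in> I (n + 1)"
    using gamma_index_exists[OF assms] gamma_index_unique[OF assms] by (metis cong_less_modulus_unique_nat)
  from theI'[OF this] show "gamma_index p OL \<pi> n k < p ^ n"
    "of_nat ((1 + p) ^ gamma_index p OL \<pi> n k) * \<omega> (int k) - of_nat k \<in> I (n + 1)"
    unfolding gamma_index_def by simp_all
qed

lemma gamma_index_eqI:
  assumes "\<not> p dvd k" "e < p ^ n" "of_nat ((1 + p) ^ e) * \<omega> (int k) - of_nat k \<in> I (n + 1)"
  shows "gamma_index p OL \<pi> n k = e"
  using gamma_index_unique[OF assms(1) gamma_index_cong assms(3)] gamma_index_less assms
  by (simp add: cong_less_modulus_unique_nat)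

end

section \<open>Isolating a single wrap\<close>

lemma finite_if_unique:
  assumes "\<And>x y. x \<in> X \<Longrightarrow> y \<in> X \<Longrightarrow> x = y" shows "finite X"
proof (cases "X = {}")
  case False
  then obtain x where "x \<in> X" by blast
  then have "X \<subseteq> {x}" using assms by blast
  then show ?thesis using finite_subset by blast
qed simp

text \<open>The left side is the product of the difference operators with steps \<open>d h\<close>,
  over all of \<open>H\<close>, applied to \<open>f\<close> at 0. Pairing \<open>A\<close> with
  \<open>insert h A\<close> carries out the operator of the chosen \<open>h\<close> first.\<close>

lemma sum_Pow_signed:
  fixes f :: "'b::comm_monoid_add \<Rightarrow> 'a::comm_ring_1"
  assumes "finite H" "h \<in> H"
  shows "(\<Sum>A\<in>Pow H. (-1) ^ card A * f (sum d A)) =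
         (\<Sum>A\<in>Pow (H - {h}). (-1) ^ card A * (f (sum d A) - f (d h + sum d A)))"
proof -
  let ?T = "Pow (H - {h})" and ?g = "\<lambda>A. (-1) ^ card A * f (sum d A)"
  have H: "Pow H = ?T \<union> insert h ` ?T" using Pow_insert[of h "H - {h}"] assms(2) by (simp add: insert_absorb)
  have "sum ?g (Pow H) = sum ?g ?T + sum ?g (insert h ` ?T)"
    unfolding H using assms(1) by (intro sum.union_disjoint) auto
  also have "sum ?g (insert h ` ?T) = (\<Sum>A\<in>?T. ?g (insert h A))"
    by (subst sum.reindex) (auto simp: inj_on_def)
  also have "\<dots> = (\<Sum>A\<in>?T. - ((-1) ^ card A * f (d h + sum d A)))"
  proof (rule sum.cong[OF refl])
    fix A assume "A \<in> ?T"
    then have "finite A" "h \<notin> A" using assms(1) finite_subset by auto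
    then show "?g (insert h A) = - ((-1) ^ card A * f (d h + sum d A))" by simp
  qed
  also have "sum ?g ?T + \<dots> = (\<Sum>A\<in>?T. ?g A + - ((-1) ^ card A * f (d h + sum d A)))"
    by (rule sum.distrib[symmetric])
  finally show ?thesis by (simp add: right_diff_distrib)
qed

text \<open>Multipliers are chosen one by one: for each of the finitely many subsets
  \<open>A\<close> at most one \<open>n\<close> is bad, as two would make a nonzero integer multiple
  of \<open>y x\<close> integral. In the application \<open>y h\<close> is
  \<open>M / h\<close>.\<close>

lemma generic_multipliers:
  fixes y :: "'b \<Rightarrow> 'a::field_char_0"
  assumes "finite S" "\<And>h n. h \<in> S \<Longrightarrow> of_int n * y h \<in> \<int> \<Longrightarrow> n = 0"
  shows "\<exists>t::'b \<Rightarrow> nat. \<forall>A\<subseteq>S. A \<noteq> {} \<longrightarrow> (\<Sum>h\<in>A. of_nat (t h) * y h) \<notin> \<int>"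
  using assms
proof (induction S)
  case (insert x S)
  then obtain t :: "'b \<Rightarrow> nat" where t: "\<And>A. A \<subseteq> S \<Longrightarrow> A \<noteq> {} \<Longrightarrow> (\<Sum>h\<in>A. of_nat (t h) * y h) \<notin> \<int>"
    by (metis insertI2)
  let ?bad = "\<lambda>A. {n::nat. of_nat n * y x + (\<Sum>h\<in>A. of_nat (t h) * y h) \<in> \<int>}"
  have "finite (?bad A)" for A
  proof (rule finite_if_unique)
    fix n m assume "n \<in> ?bad A" "m \<in> ?bad A"
    then have "of_nat n * y x - of_nat m * y x \<in> \<int>" using Ints_diff by fastforce
    then have "of_int (int n - int m) * y x \<in> \<int>" by (simp add: algebra_simps)
    then show "n = m" using insert.prems[of x "int n - int m"] by simp
  qed
  then have "finite (\<Union>A\<in>Pow S. ?bad A)" using insert.hyps by blast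
  then obtain n where n: "n \<notin> (\<Union>A\<in>Pow S. ?bad A)" using ex_new_if_finite[OF infinite_UNIV_nat] by blast
  have "(\<Sum>h\<in>A. of_nat ((t(x := n)) h) * y h) \<notin> \<int>" if A: "A \<subseteq> insert x S" "A \<noteq> {}" for A
  proof (cases "x \<in> A")
    case True
    let ?B = "A - {x}"
    have B: "?B \<subseteq> S" "finite ?B" using A insert.hyps by (auto intro: finite_subset)
    have "(\<Sum>h\<in>A. of_nat ((t(x := n)) h) * y h) = of_nat n * y x + (\<Sum>h\<in>?B. of_nat ((t(x := n)) h) * y h)"
      using sum.insert_remove[of ?B "\<lambda>h. of_nat ((t(x := n)) h) * y h" x] B(2) True
      by (simp add: insert_absorb)
    also have "(\<Sum>h\<in>?B. of_nat ((t(x := n)) h) * y h) = (\<Sum>h\<in>?B. of_nat (t h) * y h)"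
      by (intro sum.cong) auto
    finally show ?thesis using n B(1) by auto
  next
    case False
    then have "(\<Sum>h\<in>A. of_nat ((t(x := n)) h) * y h) = (\<Sum>h\<in>A. of_nat (t h) * y h)"
      by (intro sum.cong) auto
    moreover have "A \<subseteq> S" using A(1) False by auto
    ultimately show ?thesis using t[of A] A(2) by simp
  qed
  then show ?case by blast
qed auto

context padic
begin

text \<open>Translating the argument by \<open>c\<close> only matters when the residue wraps around, that is when
  \<open>x\<close> is congruent to one of \<open>0, -1, \<dots>, -c\<close>.\<close>
lemma shift_invariant:
  assumes "x \<in> Zp" "a \<in> OL" "a ^ c - 1 \<in> P" "A \<in> OL" "B \<in> OL" "\<And>j. j \<le> c \<Longrightarrow> x + of_nat j \<notin> I N"
  shows "(A * a ^ res N x + B * a ^ res N (- x)) -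
    (A * a ^ res N (x + of_nat c) + B * a ^ res N (- (x + of_nat c))) \<in> P"
proof -
  define r where "r = res N x"
  have r: "r < p ^ N" "x - of_nat r \<in> I N" using res_props[OF assms(1)] by (auto simp: r_def)
  have r0: "r \<noteq> 0" using assms(6)[of 0] res_eq_0_iff[OF assms(1), of N] by (simp add: r_def)
  \<comment> \<open>Otherwise \<open>j = p^N - r\<close> would be at most \<open>c\<close> and put
    \<open>x + j\<close> into \<open>I N\<close>.\<close>
  have rc: "r + c < p ^ N"
  proof (rule ccontr)
    assume "\<not> ?thesis"
    then have "p ^ N - r \<le> c" by simp
    moreover have "x + of_nat (p ^ N - r) = (x - of_nat r) + of_nat p ^ N"
      using r(1) by (simp add: of_nat_diff)
    moreover have "of_nat p ^ N \<in> I N" using mult_setI[OF OL_1, of "of_nat p ^ N"] by (simp only: mult_1_right)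
    ultimately show False using assms(6)[of "p ^ N - r"] ms_add[OF r(2)] by metis
  qed
  have 1: "res N (x + of_nat c) = r + c" using res_add[OF assms(1)] rc r_def by simp
  have 2: "res N (- x) = p ^ N - r" using res_minus[OF assms(1)] r0 r_def by simp
  have 3: "res N (- (x + of_nat c)) = p ^ N - (r + c)"
    using res_minus[of "x + of_nat c" N] 1 r0 assms(1) by simp
  have "p ^ N - r = (p ^ N - (r + c)) + c" using rc by simp
  then have "a ^ (p ^ N - r) = a ^ (p ^ N - (r + c)) * a ^ c" by (simp only: power_add)
  \<comment> \<open>Without a wrap one exponent grows by \<open>c\<close> and the other drops by
    \<open>c\<close>, so \<open>a^c - 1\<close> factors out.\<close>
  then have "(A * a ^ r + B * a ^ (p ^ N - r)) - (A * a ^ (r + c) + B * a ^ (p ^ N - (r + c)))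
     = (B * a ^ (p ^ N - (r + c)) - A * a ^ r) * (a ^ c - 1)"
    by (simp add: power_add algebra_simps)
  then show ?thesis unfolding 1 2 3 r_def[symmetric] using assms(2-5) by (simp add: ms_multL)
qed

text \<open>The operator of \<open>h\<close> has step \<open>M t / h\<close>: multiplied by
  \<open>h\<close> it becomes the integer \<open>M t\<close>, which \<open>shift_invariant\<close>
  controls. Of all the differences taken near \<open>- z\<close>, only that of \<open>h = 1\<close>
  at the empty subset may wrap. The predicate \<open>good\<close> stands for the arguments at which
  the sum is known to vanish modulo \<open>\<pi>\<close>.\<close>

lemma isolate_jump:
  fixes a :: 'a and A B :: "'a \<Rightarrow> 'a" and M K :: nat
  defines "G \<equiv> \<lambda>h N u. A h * a ^ res N (h * u) + B h * a ^ res N (- (h * u))"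
  assumes H: "finite H" "1 \<in> H" "\<And>h. h \<in> H \<Longrightarrow> h \<in> Zp \<and> inverse h \<in> Zp \<and> h \<noteq> 0"
    and irr: "\<And>h x y. h \<in> H - {1} \<Longrightarrow> of_int x * h = of_int y \<Longrightarrow> x = 0"
    and AB: "\<And>h. h \<in> H \<Longrightarrow> A h \<in> OL \<and> B h \<in> OL"
    and a: "a \<in> OL" and M: "M > 0" "a ^ M - 1 \<in> P"
    and good: "\<And>u v. good u \<Longrightarrow> v \<in> Zp \<Longrightarrow> good (u + of_nat M * v)"
    and hyp: "\<And>N u. N \<ge> K \<Longrightarrow> u \<in> Zp \<Longrightarrow> good u \<Longrightarrow> (\<Sum>h\<in>H. G h N u) \<in> P"
  shows "\<exists>Z. \<forall>z\<ge>Z. good (- of_nat z) \<longrightarrow>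
    (\<exists>N c. z < c \<and> c < p ^ N \<and> M dvd c \<and> G 1 N (- of_nat z) - G 1 N (- of_nat z + of_nat c) \<in> P)"
proof -
  \<comment> \<open>If \<open>n M / h\<close> is an integer \<open>m\<close>, then
    \<open>m h = n M\<close>, and irrationality of \<open>h\<close> gives
    \<open>m = 0\<close>.\<close>
  have nz: "of_int n * (of_nat M * inverse h) \<in> \<int> \<Longrightarrow> n = 0" if "h \<in> H - {1}" for h and n :: int
  proof -
    assume "of_int n * (of_nat M * inverse h) \<in> \<int>"
    then obtain m where "of_int n * (of_nat M * inverse h) = of_int m" by (auto elim: Ints_cases)
    then have e: "of_int m * h = of_int (n * int M)" using H(3)[of h] that by (simp add: field_simps)
    then have "m = 0" using irr[OF that] by blast
    then have "n * int M = 0" using e by simp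
    then show "n = 0" using M(1) by simp
  qed
  have "finite (H - {1})" using H(1) by simp
  from generic_multipliers[OF this, of "\<lambda>h. of_nat M * inverse h"] nz obtain t where
    t: "\<And>A. A \<subseteq> H - {1} \<Longrightarrow> A \<noteq> {} \<Longrightarrow> (\<Sum>h\<in>A. of_nat (t h) * (of_nat M * inverse h)) \<notin> \<int>"
    by blast
  define s where "s = (\<lambda>A. \<Sum>h\<in>A. of_nat (t h) * (of_nat M * inverse h))"
  \<comment> \<open>Exceptional integers \<open>z\<close>, for which some point met by the operator
    of \<open>h\<close> could be zero. Irrationality of \<open>h\<close> leaves at most one for each
    pair \<open>h\<close>, \<open>A\<close>, so \<open>Z\<close> can bound them all.\<close>
  define bad where "bad = (\<lambda>h A. {z::int. \<exists>j::int. h * (- of_int z + s A) + of_int j = 0})"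
  have fin_bad: "finite (bad h A)" if "h \<in> H - {1}" for h A
  proof (rule finite_if_unique)
    fix z z' assume "z \<in> bad h A" "z' \<in> bad h A"
    then obtain j j' where "h * (- of_int z + s A) + of_int j = 0" "h * (- of_int z' + s A) + of_int j' = 0"
      by (auto simp: bad_def)
    then have "h * (- of_int z + s A) + of_int j - (h * (- of_int z' + s A) + of_int j') = 0" by simp
    then have "of_int (z - z') * h = of_int (j - j')" by (simp add: algebra_simps)
    then show "z = z'" using irr[OF that] by fastforce
  qed
  have "finite (\<Union>h\<in>H - {1}. \<Union>A\<in>Pow H. bad h A)" using fin_bad H(1) by blast
  then have "finite (abs ` (\<Union>h\<in>H - {1}. \<Union>A\<in>Pow H. bad h A))" by simp
  then have "finite (insert 0 (abs ` (\<Union>h\<in>H - {1}. \<Union>A\<in>Pow H. bad h A)))" by (rule finite.insertI)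
  from Max_ge[OF this] obtain Z0 where
    Z0: "\<And>b. b \<in> abs ` (\<Union>h\<in>H - {1}. \<Union>A\<in>Pow H. bad h A) \<Longrightarrow> b \<le> Z0" by blast
  define Z where "Z = nat Z0 + 1"
  have Z: "\<bar>b\<bar> < int Z" if "b \<in> bad h A" "h \<in> H - {1}" "A \<subseteq> H" for b h A
  proof -
    have "\<bar>b\<bar> \<in> abs ` (\<Union>h\<in>H - {1}. \<Union>A\<in>Pow H. bad h A)" using that by blast
    from Z0[OF this] show ?thesis unfolding Z_def by linarith
  qed
  show ?thesis
  proof (rule exI[of _ Z], intro allI impI)
    fix z assume z: "z \<ge> Z" "good (- of_nat z)"
    \<comment> \<open>The multiplier of \<open>h = 1\<close> is still free. It is taken so large
      that the shift \<open>c\<close> exceeds \<open>z + Z\<close>; then \<open>z - c\<close> lies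
      below \<open>- Z\<close>, out of reach of the exceptional integers.\<close>
    define t' where "t' = t(1 := z + Z + 1)"
    define d where "d = (\<lambda>h. of_nat (t' h) * (of_nat M * inverse h))"
    define c where "c = M * t' 1"
    have "1 * (z + Z + 1) \<le> c" using M(1) unfolding c_def t'_def by (intro mult_le_mono) auto
    then have c: "z + Z < c" by simp
    have sd: "sum d C = s C" if "1 \<notin> C" for C
      unfolding d_def s_def t'_def using that by (intro sum.cong) auto
    have d1: "d 1 = of_nat c" by (simp add: d_def c_def)
    \<comment> \<open>Indices of all points that must avoid \<open>I N\<close>. The removed triples,
      \<open>h = 1\<close> with \<open>C\<close> empty, belong to the one wrap that is kept.\<close>
    define T where "T = (SIGMA h:H. SIGMA C:Pow (H - {h}). {..M * t' h}) - {1} \<times> {{}} \<times> UNIV"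
    define X where "X = (\<lambda>(h, C, j). h * (- of_nat z + sum d C) + of_nat j) ` T"
    have fX: "finite X" unfolding X_def T_def using H(1) by (intro finite_imageI finite_Diff finite_SigmaI) auto
    have "0 \<notin> X"
    proof
      assume "0 \<in> X"
      then obtain x where x: "x \<in> T" "0 = (\<lambda>(h, C, j). h * (- of_nat z + sum d C) + of_nat j) x"
        unfolding X_def by blast
      obtain h C j where hCj: "x = (h, C, j)" by (cases x)
      have h: "h \<in> H" "C \<subseteq> H - {h}" "h = 1 \<Longrightarrow> C \<noteq> {}" using x(1) by (auto simp: T_def hCj)
      have e: "h * (- of_nat z + sum d C) + of_nat j = 0" using x(2) unfolding hCj by simp
      show False
      proof (cases "h = 1")
        \<comment> \<open>For \<open>h = 1\<close> a zero would make \<open>s C\<close> an integer,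
          against the choice of \<open>t\<close>.\<close>
        case True
        then have "1 \<notin> C" using h(2) by auto
        then have "s C = of_int (int z - int j)" using e sd[of C] True by (simp add: algebra_simps)
        then have "s C \<in> \<int>" by simp
        then show False using t[of C] h True by (simp add: s_def)
      next
        case False
        show False
        proof (cases "1 \<in> C")
          \<comment> \<open>The share of 1 in the shift is the integer \<open>c\<close>, so
            \<open>z\<close> is replaced by \<open>z - c\<close>.\<close>
          case True
          have "finite C" using h(2) H(1) finite_subset by blast
          then have "sum d C = d 1 + sum d (C - {1})" using True by (rule sum.remove)
          also have "\<dots> = of_nat c + s (C - {1})" using sd[of "C - {1}"] d1 by simp
          finally have "h * (- of_int (int z - int c) + s (C - {1})) + of_int (int j) = 0"
            using e by (simp add: algebra_simps)
          then have "int z - int c \<in> bad h (C - {1})" unfolding bad_def by blast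
          then have "\<bar>int z - int c\<bar> < int Z" using Z[of "int z - int c" h "C - {1}"] h False by auto
          then show False using c by simp
        next
          case nC: False
          then have "h * (- of_int (int z) + s C) + of_int (int j) = 0" using e sd[of C] by simp
          then have "int z \<in> bad h C" unfolding bad_def by blast
          then have "\<bar>int z\<bar> < int Z" using Z[of "int z" h C] h False by auto
          then show False using z(1) by simp
        qed
      qed
    qed
    from eventually_notin_I[OF fX this] obtain N1 where N1: "\<And>N x. N \<ge> N1 \<Longrightarrow> x \<in> X \<Longrightarrow> x \<notin> I N"
      by blast
    \<comment> \<open>Besides the bounds \<open>K\<close> and \<open>N1\<close>,
      \<open>N \<ge> c\<close> guarantees \<open>c < p^N\<close>.\<close>
    define N where "N = max K (max N1 c)"
    have N: "N \<ge> K" "N \<ge> N1" "c \<le> N" by (auto simp: N_def)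
    have "N < p ^ N" using p_gt by (intro power_gt_expt) auto
    then have cN: "c < p ^ N" using N(3) by simp
    have d_Zp: "d h \<in> Zp" if "h \<in> H" for h using H(3)[OF that] by (simp add: d_def)
    have sum_Zp: "sum d C \<in> Zp" if "C \<subseteq> H" for C using that d_Zp by (intro Zp_sum) auto
    let ?u = "\<lambda>x. - of_nat z + x :: 'a"
    have u_good: "good (?u (sum d C))" if "C \<subseteq> H" for C
    proof -
      have "sum d C = of_nat M * (\<Sum>h\<in>C. of_nat (t' h) * inverse h)"
        by (simp add: d_def sum_distrib_left mult_ac)
      moreover have "(\<Sum>h\<in>C. of_nat (t' h) * inverse h) \<in> Zp" using that H(3) by (intro Zp_sum) auto
      ultimately show ?thesis using good[OF z(2)] by simp
    qed
    \<comment> \<open>Every shifted argument is good, so the alternating sum of the hypotheses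
      applies; it is then reordered by \<open>h\<close>.\<close>
    have total: "(\<Sum>h\<in>H. \<Sum>C\<in>Pow H. (-1) ^ card C * G h N (?u (sum d C))) \<in> P"
    proof -
      have "(\<Sum>C\<in>Pow H. (-1) ^ card C * (\<Sum>h\<in>H. G h N (?u (sum d C)))) \<in> P"
      proof (rule ms_sum)
        fix C assume "C \<in> Pow H"
        then have "(\<Sum>h\<in>H. G h N (?u (sum d C))) \<in> P"
          using u_good[of C] sum_Zp[of C] by (intro hyp[OF N(1)] Zp_add) auto
        then show "(-1) ^ card C * (\<Sum>h\<in>H. G h N (?u (sum d C))) \<in> P" by (rule ms_multL[rotated]) simp
      qed
      then show ?thesis by (subst sum.swap) (simp add: sum_distrib_left)
    qed
    have split: "(\<Sum>C\<in>Pow H. (-1) ^ card C * G h N (?u (sum d C))) =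
       (\<Sum>C\<in>Pow (H - {h}). (-1) ^ card C * (G h N (?u (sum d C)) - G h N (?u (d h + sum d C))))"
      if "h \<in> H" for h
      using sum_Pow_signed[OF H(1) that, of "\<lambda>x. G h N (?u x)" d] .
    have bracket: "G h N (?u (sum d C)) - G h N (?u (d h + sum d C)) \<in> P"
      if h: "h \<in> H" "C \<subseteq> H - {h}" "h = 1 \<Longrightarrow> C \<noteq> {}" for h C
    proof -
      define x where "x = h * ?u (sum d C)"
      have "h * d h = of_nat (M * t' h)" using H(3)[OF h(1)] by (simp add: d_def)
      then have x': "h * ?u (d h + sum d C) = x + of_nat (M * t' h)" by (simp add: x_def algebra_simps)
      have xZ: "x \<in> Zp" unfolding x_def using H(3)[OF h(1)] h(2) by (intro Zp_mult Zp_add sum_Zp) auto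
      have "a ^ (M * t' h) - 1 \<in> P"
        using ms_power_cong[OF M(2), of "t' h"] a by (simp add: power_mult)
      moreover have "x + of_nat j \<notin> I N" if "j \<le> M * t' h" for j
      proof (rule N1[OF N(2)])
        show "x + of_nat j \<in> X" unfolding X_def x_def using h that
          by (intro image_eqI[of _ _ "(h, C, j)"]) (auto simp: T_def)
      qed
      ultimately show ?thesis unfolding G_def x' x_def[symmetric]
        using shift_invariant[OF xZ a, of "M * t' h" "A h" "B h" N] AB[OF h(1)] by blast
    qed
    let ?T = "\<lambda>h. \<Sum>C\<in>Pow H. (-1) ^ card C * G h N (?u (sum d C))"
    \<comment> \<open>For \<open>h \<noteq> 1\<close> no difference wraps, so only the contribution
      of \<open>h = 1\<close> is left.\<close>
    have "?T h \<in> P" if "h \<in> H - {1}" for h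
      unfolding split[of h, OF DiffD1[OF that]] using that bracket by (intro ms_sum ms_multL) auto
    then have "(\<Sum>h\<in>H - {1}. ?T h) \<in> P" by (rule ms_sum)
    moreover have "(\<Sum>h\<in>H. ?T h) = ?T 1 + (\<Sum>h\<in>H - {1}. ?T h)" using H by (simp add: sum.remove)
    ultimately have "?T 1 \<in> P" using ms_diff[OF total] by fastforce
    moreover let ?f = "\<lambda>C. (-1) ^ card C * (G 1 N (?u (sum d C)) - G 1 N (?u (d 1 + sum d C)))"
    \<comment> \<open>For \<open>h = 1\<close> the differences at nonempty \<open>C\<close> do not
      wrap either.\<close>
    have "?T 1 = ?f {} + (\<Sum>C\<in>Pow (H - {1}) - {{}}. ?f C)"
      unfolding split[OF H(2)] using H(1) by (intro sum.remove) auto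
    moreover have "(\<Sum>C\<in>Pow (H - {1}) - {{}}. ?f C) \<in> P"
      using bracket[OF H(2)] by (intro ms_sum ms_multL) auto
    ultimately have "?f {} \<in> P" using ms_diff[of "?T 1" \<pi>] by fastforce
    then have "G 1 N (- of_nat z) - G 1 N (- of_nat z + of_nat c) \<in> P" by (simp add: d1)
    moreover have "z < c" "M dvd c" using c by (auto simp: c_def)
    ultimately show "\<exists>N c. z < c \<and> c < p ^ N \<and> M dvd c \<and> G 1 N (- of_nat z) - G 1 N (- of_nat z + of_nat c) \<in> P"
      using cN by blast
  qed
qed

text \<open>Modulo \<open>a^c = 1\<close>, multiplying the jump by \<open>a^z * a^c\<close> gives
  \<open>(q - 1) * (1 - b * a^(2 * z))\<close> with \<open>q = a^(p^N)\<close>, and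
  \<open>q - 1\<close> is a unit by \<open>frobenius_P\<close>.\<close>

lemma jump_at_one:
  assumes a: "a \<in> OL" "a - 1 \<notin> P" and c: "z < c" "c < p ^ N" "a ^ c - 1 \<in> P" and z: "z > 0"
    and jump: "(a ^ res N (- of_nat z) + b * a ^ res N (of_nat z)) -
      (a ^ res N (- of_nat z + of_nat c) + b * a ^ res N (- (- of_nat z + of_nat c))) \<in> P"
    and b: "b \<in> OL"
  shows "1 - b * a ^ (2 * z) \<in> P"
proof -
  define q where "q = a ^ (p ^ N)"
  have r1: "res N (of_nat k) = k" if "k < p ^ N" for k using that by (intro res_eqI) auto
  have r2: "res N (- of_nat k) = p ^ N - k" if "0 < k" "k < p ^ N" for k
    using res_minus[of "of_nat k" N] r1[OF that(2)] that by simp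
  \<comment> \<open>Since \<open>z < c\<close>, the shift carries \<open>- z\<close> past 0, and the
    new representative is \<open>c - z\<close> instead of \<open>p^N - z + c\<close>.\<close>
  have c': "- of_nat z + of_nat c = (of_nat (c - z) :: 'a)" using c(1) by (simp add: of_nat_diff)
  let ?D = "(a ^ (p ^ N - z) + b * a ^ z) - (a ^ (c - z) + b * a ^ (p ^ N - (c - z)))"
  have D: "?D \<in> P" using jump r1[of z] r2[of z] r1[of "c - z"] r2[of "c - z"] z c
    unfolding c' by simp
  have e1: "a ^ z * a ^ (p ^ N - z) = q" using c by (simp add: q_def flip: power_add)
  have e2: "a ^ z * a ^ (c - z) = a ^ c" using c by (simp flip: power_add)
  have e3: "a ^ z * a ^ c * a ^ (p ^ N - (c - z)) = q * a ^ (2 * z)"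
    using c by (simp add: q_def mult_2 add_ac flip: power_add)
  have e4: "a ^ z * a ^ z = a ^ (2 * z)" by (simp add: mult_2 flip: power_add)
  have "a ^ z * a ^ c * ?D = a ^ c * (a ^ z * a ^ (p ^ N - z)) + b * a ^ c * (a ^ z * a ^ z)
       - a ^ c * (a ^ z * a ^ (c - z)) - b * (a ^ z * a ^ c * a ^ (p ^ N - (c - z)))"
    by (simp add: algebra_simps)
  also have "\<dots> = a ^ c * q + b * a ^ c * a ^ (2 * z) - a ^ c * a ^ c - b * (q * a ^ (2 * z))"
    unfolding e1 e2 e3 e4 ..
  also have "\<dots> = (q - 1) * (1 - b * a ^ (2 * z)) + (a ^ c - 1) * (q + b * a ^ (2 * z) - a ^ c - 1)"
    by (simp add: algebra_simps)
  finally have "(q - 1) * (1 - b * a ^ (2 * z)) =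
    a ^ z * a ^ c * ?D - (a ^ c - 1) * (q + b * a ^ (2 * z) - a ^ c - 1)" by simp
  moreover have "a ^ z * a ^ c * ?D \<in> P" using D a by (intro ms_multL) auto
  moreover have "(a ^ c - 1) * (q + b * a ^ (2 * z) - a ^ c - 1) \<in> P"
    using c(3) a b by (intro ms_multR) (auto simp: q_def)
  ultimately have "(q - 1) * (1 - b * a ^ (2 * z)) \<in> P" using ms_diff by metis
  moreover have "q - 1 \<notin> P" using frobenius_P[OF a(1)] a(2) unfolding q_def by blast
  ultimately show ?thesis using P_prime[of "q - 1" "1 - b * a ^ (2 * z)"] a b by (auto simp: q_def)
qed

end

section \<open>Filtered power series\<close>

unbundle fps_syntax

lemma one_plus_fps_X_power_nth: "((1 + fps_X :: 'a::comm_ring_1 fps) ^ m) $ j = of_nat (m choose j)"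
proof -
  have "(1 + fps_X :: 'a fps) ^ m = (\<Sum>k\<le>m. of_nat (m choose k) * fps_X ^ k)"
    by (subst add.commute, subst binomial_ring) simp
  also have "\<dots> $ j = (\<Sum>k\<le>m. if k = j then of_nat (m choose k) else 0)"
    unfolding fps_sum_nth by (intro sum.cong) (auto simp: fps_of_nat[symmetric])
  also have "\<dots> = of_nat (m choose j)" by (simp add: binomial_eq_0)
  finally show ?thesis .
qed

text \<open>Since \<open>j * (p^n choose j)\<close> is a multiple of \<open>p^n\<close>, a binomial
  coefficient prime to \<open>p\<close> would force \<open>p^n\<close> to divide
  \<open>j\<close>.\<close>

lemma prime_dvd_choose_prime_power:
  assumes "prime p" "0 < j" "j < p ^ n" shows "p dvd (p ^ n choose j)"
proof (rule ccontr)
  assume "\<not> p dvd (p ^ n choose j)"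
  then have "coprime (p ^ n) (p ^ n choose j)" using assms(1) by (simp add: prime_imp_coprime)
  moreover have "p ^ n dvd j * (p ^ n choose j)"
    using times_binomial_minus1_eq[OF assms(2), of "p ^ n"] by simp
  ultimately have "p ^ n dvd j" by (simp add: coprime_dvd_mult_left_iff)
  then show False using assms(2,3) by (simp add: nat_dvd_not_less)
qed

context padic
begin

text \<open>The \<open>k\<close>-th power of the maximal ideal of the power series ring.\<close>
definition J :: "nat \<Rightarrow> 'a fps set" where
  "J k = {f. \<forall>j. f $ j \<in> mult_set (\<pi> ^ (k - j)) OL}"

lemma ms_1: "mult_set 1 OL = OL"
  by (auto simp: mult_set_def)

lemma J_0_iff: "f \<in> J 0 \<longleftrightarrow> (\<forall>j. f $ j \<in> OL)"
  by (simp add: J_def ms_1)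

lemma J_0D: "f \<in> J 0 \<Longrightarrow> f $ j \<in> OL"
  by (simp add: J_0_iff)

lemma J_mono: "k \<le> l \<Longrightarrow> J l \<subseteq> J k"
  unfolding J_def using pi_power_mono by (blast intro: diff_le_mono)

lemma J_zero [simp]: "0 \<in> J k" by (simp add: J_def)

lemma J_add: "f \<in> J k \<Longrightarrow> g \<in> J k \<Longrightarrow> f + g \<in> J k"
  by (simp add: J_def ms_add)

lemma J_diff: "f \<in> J k \<Longrightarrow> g \<in> J k \<Longrightarrow> f - g \<in> J k"
  by (simp add: J_def ms_diff)

lemma J_sum: "(\<And>x. x \<in> A \<Longrightarrow> f x \<in> J k) \<Longrightarrow> sum f A \<in> J k"
  by (induction A rule: infinite_finite_induct) (auto intro: J_add)

lemma J_mult: assumes "f \<in> J k" "g \<in> J l" shows "f * g \<in> J (k + l)"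
  unfolding J_def mem_Collect_eq fps_mult_nth
proof (intro allI ms_sum)
  fix n i :: nat assume i: "i \<in> {0..n}"
  have "f $ i * g $ (n - i) \<in> mult_set (\<pi> ^ (k - i) * \<pi> ^ (l - (n - i))) OL"
    using assms by (intro ms_mult) (auto simp: J_def)
  moreover have "k + l - n \<le> (k - i) + (l - (n - i))" using i by auto
  ultimately show "f $ i * g $ (n - i) \<in> mult_set (\<pi> ^ (k + l - n)) OL"
    using pi_power_mono unfolding power_add[symmetric] by blast
qed

lemma J_0_mult [simp]: "f \<in> J 0 \<Longrightarrow> g \<in> J 0 \<Longrightarrow> f * g \<in> J 0"
  using J_mult[of f 0 g 0] by simp

lemma J_0_const [simp]: "c \<in> OL \<Longrightarrow> fps_const c \<in> J 0"
  by (simp add: J_0_iff)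

lemma J_0_one_plus_X_power [simp]: "(1 + fps_X) ^ m \<in> J 0"
  by (simp add: J_0_iff one_plus_fps_X_power_nth)

lemma J_1I: "f \<in> J 0 \<Longrightarrow> f $ 0 \<in> P \<Longrightarrow> f \<in> J 1"
  unfolding J_def mem_Collect_eq
proof
  fix j assume "\<forall>j. f $ j \<in> mult_set (\<pi> ^ (0 - j)) OL" "f $ 0 \<in> P"
  then show "f $ j \<in> mult_set (\<pi> ^ (1 - j)) OL" by (cases j) auto
qed

lemma J_Inter: assumes "\<And>k. f \<in> J k" shows "f = 0"
proof (rule fps_ext)
  fix j
  have "f $ j \<in> mult_set (\<pi> ^ n) OL" for n using assms[of "n + j"] unfolding J_def mem_Collect_eq by (metis diff_add_inverse2)
  then show "f $ j = 0 $ j" using pi_power_Inter by simp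
qed

lemma J_complete:
  assumes "\<And>n. f n \<in> J 0" "\<And>n. f (Suc n) - f n \<in> J n"
  obtains g where "g \<in> J 0" "\<And>n. g - f n \<in> J n"
proof -
  \<comment> \<open>Coefficient \<open>j\<close> of an element of \<open>J n\<close> is small only
    to order \<open>n - j\<close>, so its sequence is read from index \<open>j\<close> on.\<close>
  have "\<exists>y\<in>OL. \<forall>n. y - f (n + j) $ j \<in> mult_set (\<pi> ^ n) OL" for j
  proof (rule complete[of "\<lambda>n. f (n + j) $ j"])
    fix n
    show "f (n + j) $ j \<in> OL" using assms(1) J_0D by blast
    have "f (Suc (n + j)) - f (n + j) \<in> J (n + j)" by (rule assms(2))
    then have "(f (Suc (n + j)) - f (n + j)) $ j \<in> mult_set (\<pi> ^ (n + j - j)) OL" unfolding J_def by blast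
    then show "f (Suc n + j) $ j - f (n + j) $ j \<in> mult_set (\<pi> ^ n) OL" by simp
  qed blast
  then obtain y where y: "\<And>j. y j \<in> OL" "\<And>j n. y j - f (n + j) $ j \<in> mult_set (\<pi> ^ n) OL" by metis
  have "Abs_fps y - f n \<in> J n" for n
    unfolding J_def mem_Collect_eq
  proof
    fix j
    show "(Abs_fps y - f n) $ j \<in> mult_set (\<pi> ^ (n - j)) OL"
    proof (cases "j \<le> n")
      case True
      then show ?thesis using y(2)[of j "n - j"] by simp
    next
      case False
      then show ?thesis using y(1) assms(1)[of n] J_0D by (simp add: ms_1)
    qed
  qed
  moreover have "Abs_fps y \<in> J 0" using y(1) by (simp add: J_0_iff)
  ultimately show ?thesis using that by blast
qed

section \<open>The polynomials \<open>(1 + T)^(p^n) - 1\<close> and the inverse limit modulo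
  them\<close>

definition Pn :: "nat \<Rightarrow> 'a fps" where "Pn n = (1 + fps_X) ^ (p ^ n) - 1"

lemma Pn_J: "Pn n \<in> J 0"
proof -
  have "1 \<in> J 0" using J_0_const[of 1] by (simp del: J_0_const)
  then show ?thesis unfolding Pn_def by (intro J_diff) auto
qed

lemma Pn_Suc_dvd: obtains \<Phi> where "\<Phi> \<in> J 1" "Pn (Suc n) = Pn n * \<Phi>"
proof
  \<comment> \<open>The quotient of consecutive polynomials is a geometric sum of \<open>p\<close>
    terms. Its constant term is \<open>p\<close>, which puts it into \<open>J 1\<close>.\<close>
  let ?F = "\<Sum>j<p. ((1 + fps_X) ^ (p ^ n)) ^ j :: 'a fps"
  have F: "?F = (\<Sum>j<p. (1 + fps_X) ^ (p ^ n * j))" by (simp add: power_mult)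
  show "?F \<in> J 1"
  proof (rule J_1I)
    show "?F \<in> J 0" unfolding F by (intro J_sum) simp
    show "?F $ 0 \<in> P" unfolding F fps_sum_nth one_plus_fps_X_power_nth using p_in_P by simp
  qed
  show "Pn (Suc n) = Pn n * ?F"
    unfolding Pn_def power_diff_1_eq[symmetric] by (simp add: mult.commute flip: power_mult)
qed

lemma Pn_J_Suc: "Pn n \<in> J (Suc n)"
proof (induction n)
  case 0
  show ?case using J_1I[OF Pn_J[of 0]] by (simp add: Pn_def)
next
  case (Suc n)
  obtain \<Phi> where "\<Phi> \<in> J 1" "Pn (Suc n) = Pn n * \<Phi>" by (rule Pn_Suc_dvd)
  then show ?case using J_mult[OF Suc, of \<Phi> 1] by simp
qed

lemma Pn_add_dvd: "\<exists>E\<in>J l. Pn (n + l) = Pn n * E"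
proof (induction l)
  case 0
  have "1 \<in> J 0" using J_0_const[of 1] by (simp del: J_0_const)
  then show ?case by (intro bexI[of _ 1]) auto
next
  case (Suc l)
  then obtain E where E: "E \<in> J l" "Pn (n + l) = Pn n * E" by blast
  obtain \<Phi> where "\<Phi> \<in> J 1" "Pn (Suc (n + l)) = Pn (n + l) * \<Phi>" by (rule Pn_Suc_dvd)
  then show ?case using J_mult[OF E(1), of \<Phi> 1] E(2) by (intro bexI[of _ "E * \<Phi>"]) (auto simp: mult.assoc)
qed

text \<open>A limit \<open>g\<close> exists because the increments tend to 0. That
  \<open>g - f n\<close> is divisible by \<open>Pn n\<close> is seen by summing the quotients of the
  increments by \<open>Pn n\<close>, a series that converges as well.\<close>

lemma inverse_limit_exists:
  assumes f: "\<And>n. f n \<in> J 0" "\<And>n. \<exists>Q\<in>J 0. f (Suc n) - f n = Pn n * Q"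
  shows "\<exists>M\<in>J 0. \<forall>n. \<exists>Q\<in>J 0. M - f n = Pn n * Q"
proof -
  obtain Q where Q: "\<And>n. Q n \<in> J 0" "\<And>n. f (Suc n) - f n = Pn n * Q n" using f(2) by metis
  have fJ: "f (Suc n) - f n \<in> J n" for n
    using J_mult[OF Pn_J_Suc Q(1), of n n] J_mono[of n "Suc n"] unfolding Q(2) by auto
  obtain g where g: "g \<in> J 0" "\<And>n. g - f n \<in> J n" using J_complete[of f] f(1) fJ by blast
  have "\<exists>R\<in>J 0. g - f n = Pn n * R" for n
  proof -
    obtain E where E: "\<And>l. E l \<in> J l" "\<And>l. Pn (n + l) = Pn n * E l" using Pn_add_dvd[of _ n] by metis
    define R where "R = (\<lambda>m. \<Sum>l<m. E l * Q (n + l))"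
    have EQ: "E l * Q (n + l) \<in> J l" for l using J_mult[OF E(1) Q(1), of l "n + l"] by simp
    have R_J: "R m \<in> J 0" for m unfolding R_def using EQ J_mono by (intro J_sum) blast
    have fR: "f (n + m) - f n = Pn n * R m" for m
    proof (induction m)
      case (Suc m)
      have "f (n + Suc m) - f n = (f (Suc (n + m)) - f (n + m)) + (f (n + m) - f n)" by simp
      also have "\<dots> = Pn n * R (Suc m)" unfolding Suc Q(2) E(2) by (simp add: R_def algebra_simps)
      finally show ?case .
    qed (simp add: R_def)
    obtain R' where R': "R' \<in> J 0" "\<And>m. R' - R m \<in> J m"
      using J_complete[of R] R_J EQ by (auto simp: R_def)
    have "g - f n - Pn n * R' \<in> J m" for m
    proof -
      have "g - f n - Pn n * R' = (g - f (n + m)) - Pn n * (R' - R m)"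
        using fR[of m] by (simp add: algebra_simps)
      moreover have "g - f (n + m) \<in> J m" using g(2)[of "n + m"] J_mono[of m "n + m"] by auto
      moreover have "Pn n * (R' - R m) \<in> J m" using J_mult[OF Pn_J R'(2), of n m] by simp
      ultimately show ?thesis using J_diff by metis
    qed
    then have "g - f n - Pn n * R' = 0" by (rule J_Inter)
    then have "g - f n = Pn n * R'" by simp
    then show ?thesis using R'(1) by blast
  qed
  then show ?thesis using g(1) by blast
qed

text \<open>Two limits differ by a multiple of every \<open>Pn n\<close>, and \<open>Pn n\<close>
  tends to 0.\<close>

lemma inverse_limit_unique:
  assumes "\<And>n. \<exists>Q\<in>J 0. M - f n = Pn n * Q" "\<And>n. \<exists>Q\<in>J 0. M' - f n = Pn n * Q"
  shows "M = M'"
proof -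
  have "M - M' \<in> J n" for n
  proof -
    obtain Q Q' where Q: "Q \<in> J 0" "M - f n = Pn n * Q" "Q' \<in> J 0" "M' - f n = Pn n * Q'"
      using assms by metis
    have "M - M' = Pn n * Q - Pn n * Q'" using Q(2,4) by (metis diff_diff_eq2 diff_add_cancel)
    also have "\<dots> = Pn n * (Q - Q')" by (simp add: right_diff_distrib)
    finally show ?thesis using J_mult[OF Pn_J_Suc J_diff[OF Q(1,3)], of n] J_mono[of n "Suc n"] by auto
  qed
  then have "M - M' = 0" by (rule J_Inter)
  then show ?thesis by simp
qed

section \<open>Reading off coefficients of a layer modulo \<open>\<pi>\<close>\<close>

lemma Pn_nth_P: "j < p ^ n \<Longrightarrow> Pn n $ j \<in> P"
  using prime_dvd_choose_prime_power[OF prime, of j n]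
  by (cases "j = 0") (auto simp: Pn_def one_plus_fps_X_power_nth of_nat_P_iff)

lemma mult_nth_P:
  assumes "\<And>i. i < m \<Longrightarrow> f $ i \<in> P" "g \<in> J 0" "j < m" shows "(f * g) $ j \<in> P"
  unfolding fps_mult_nth using assms by (intro ms_sum ms_multR) (auto intro: J_0D)

text \<open>The \<open>(1 + T)^e\<close> with \<open>e < m\<close> are unitriangular over the powers
  of \<open>T\<close>; their coefficients vanish modulo \<open>\<pi>\<close> one after another, from
  the largest \<open>e\<close> down.\<close>

lemma binomial_triangular:
  assumes "\<And>e. d e \<in> OL" "\<And>j. j < m \<Longrightarrow> (\<Sum>e<m. d e * of_nat (e choose j)) \<in> P" "e < m"
  shows "d e \<in> P"
  using assms(3)
proof (induction "m - e" arbitrary: e rule: less_induct)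
  case less
  have "(\<Sum>k<m. d k * of_nat (k choose e)) = d e * of_nat (e choose e) + (\<Sum>k\<in>{..<m} - {e}. d k * of_nat (k choose e))"
    using less.prems by (intro sum.remove) auto
  moreover have "(\<Sum>k\<in>{..<m} - {e}. d k * of_nat (k choose e)) \<in> P"
  proof (rule ms_sum)
    fix k assume k: "k \<in> {..<m} - {e}"
    show "d k * of_nat (k choose e) \<in> P"
    proof (cases "k < e")
      case True then show ?thesis by (simp add: binomial_eq_0)
    next
      case False
      then show ?thesis using k less.hyps[of k] by (intro ms_multR) auto
    qed
  qed
  ultimately show ?case using ms_diff[OF assms(2)[OF less.prems], of "(\<Sum>k\<in>{..<m} - {e}. d k * of_nat (k choose e))"]
    by simp
qed

text \<open>The operator \<open>(1 + T) d/dT\<close> multiplies \<open>(1 + T)^e\<close> by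
  \<open>e\<close>, which is a unit if \<open>p\<close> does not divide \<open>e\<close>. The term
  \<open>Pn n * Q\<close> contributes nothing modulo \<open>\<pi>\<close> in degrees below
  \<open>p^n\<close>: \<open>Pn n\<close> is \<open>T^(p^n)\<close> there, and its derivative
  carries the factor \<open>p^n\<close>.\<close>

lemma deriv_P_imp_coeff_P:
  assumes c: "\<And>e. c e \<in> OL" and n: "n > 0" and Q: "Q \<in> J 0"
    and M: "M = (\<Sum>e<p ^ n. fps_const (c e) * (1 + fps_X) ^ e) + Pn n * Q"
    and D: "\<And>j. fps_deriv M $ j \<in> P" and e: "e < p ^ n" "\<not> p dvd e"
  shows "c e \<in> P"
proof -
  let ?X = "1 + fps_X :: 'a fps"
  define N where "N = (\<Sum>e<p ^ n. fps_const (c e) * ?X ^ e)"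
  have X: "?X \<in> J 0" using J_0_one_plus_X_power[of 1] by (simp del: J_0_one_plus_X_power)
  have dQ: "fps_deriv Q \<in> J 0" using Q by (simp add: J_0_iff del: of_nat_Suc)
  have dP: "fps_deriv (Pn n) $ j \<in> P" for j
  proof -
    have "of_nat (p ^ n) \<in> P" unfolding of_nat_P_iff using n by simp
    then show ?thesis using J_0D[OF J_0_one_plus_X_power[of "p ^ n - 1"], of j]
      by (simp add: Pn_def fps_deriv_power ms_multR del: of_nat_power)
  qed
  have XN: "(?X * fps_deriv N) $ j \<in> P" if "j < p ^ n" for j
  proof -
    have "fps_deriv N = fps_deriv M - (fps_deriv (Pn n) * Q + Pn n * fps_deriv Q)"
      unfolding M N_def by (simp add: algebra_simps)
    moreover have "(fps_deriv (Pn n) * Q) $ i \<in> P" for i using mult_nth_P[of "Suc i", OF dP Q] by blast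
    moreover have "(Pn n * fps_deriv Q) $ i \<in> P" if "i < p ^ n" for i
      using mult_nth_P[OF Pn_nth_P dQ] that by blast
    ultimately have "fps_deriv N $ i \<in> P" if "i < p ^ n" for i
      using D that by (simp add: ms_add ms_diff)
    from mult_nth_P[OF this X that] show ?thesis by (simp only: mult.commute)
  qed
  have "?X * fps_deriv (fps_const (c e) * ?X ^ e) = fps_const (c e * of_nat e) * ?X ^ e" for e
  proof (cases e)
    case (Suc k)
    have "fps_deriv (?X ^ e) = fps_const (of_nat e) * ?X ^ k"
      unfolding fps_deriv_power by (simp add: Suc del: of_nat_Suc)
    then have "?X * fps_deriv (fps_const (c e) * ?X ^ e) = ?X * (fps_const (c e) * (fps_const (of_nat e) * ?X ^ k))"
      by (simp only: fps_deriv_mult fps_deriv_const) simp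
    also have "\<dots> = fps_const (c e) * fps_const (of_nat e) * (?X * ?X ^ k)"
      by (simp only: mult_ac)
    finally show ?thesis by (simp add: Suc)
  qed simp
  then have "?X * fps_deriv N = (\<Sum>e<p ^ n. fps_const (c e * of_nat e) * ?X ^ e)"
    by (simp add: N_def fps_deriv_sum sum_distrib_left)
  then have "(\<Sum>e<p ^ n. (c e * of_nat e) * of_nat (e choose j)) \<in> P" if "j < p ^ n" for j
    using XN[OF that] by (simp add: fps_sum_nth one_plus_fps_X_power_nth)
  then have "c e * of_nat e \<in> P" using c e(1) by (intro binomial_triangular[of "\<lambda>e. c e * of_nat e" "p ^ n"]) auto
  then show ?thesis using P_prime[OF c OL_of_nat] e(2) of_nat_P_iff by blast
qed

lemma coeff_P_imp_P:
  assumes Q: "Q \<in> J 0" and M: "M = (\<Sum>e<p ^ n. fps_const (c e) * (1 + fps_X) ^ e) + Pn n * Q"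
    and c: "\<And>e. e < p ^ n \<Longrightarrow> c e \<in> P" and j: "j < p ^ n"
  shows "M $ j \<in> P"
proof -
  have "(\<Sum>e<p ^ n. fps_const (c e) * (1 + fps_X) ^ e) $ j \<in> P"
    using c by (auto simp: fps_sum_nth one_plus_fps_X_power_nth intro!: ms_sum ms_multR)
  moreover have "(Pn n * Q) $ j \<in> P" using mult_nth_P[OF Pn_nth_P Q j] .
  ultimately show ?thesis unfolding M by (simp add: ms_add)
qed

end

section \<open>The power series \<open>M\<close>\<close>

lemma (in padic) teich_cong_mod:
  assumes "\<not> p dvd k" "[k = l] (mod p)" shows "\<omega> (int l) = \<omega> (int k)"
proof (rule teich_eqI[OF teich_OL teich_power])
  have "of_int (int k - int l) \<in> P" unfolding of_int_P_iff
    using assms(2) by (simp add: cong_iff_dvd_diff flip: cong_int_iff)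
  then show "\<omega> (int k) - of_int (int l) \<in> P" using ms_add[OF teich_cong[OF assms(1)], of "of_nat k - of_nat l"] by simp
qed (use assms in auto)

locale padic_measure = padic +
  fixes a :: 'a and i :: nat
  assumes a: "a \<in> OL" and a_a1: "a * (a - 1) \<notin> P"
begin

lemma a_notin_P: "a \<notin> P" and a1_notin_P: "a - 1 \<notin> P"
  using a a_a1 ms_multL[of a] ms_multR[of a] by auto

text \<open>This makes the denominators of \<open>M_n\<close> units.\<close>

lemma a_power_notin_P: "a ^ (p ^ N) - 1 \<notin> P"
  using frobenius_P[OF a] a1_notin_P by blast

lemma a_power_neq_1: "a ^ (p ^ N) \<noteq> 1"
  using a_power_notin_P[of N] by auto

section \<open>The layers \<open>M_n\<close>: integrality, compatibility and limit\<close>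

abbreviation "idx \<equiv> gamma_index p OL \<pi>"
abbreviation "coef \<equiv> Mn_coeff p OL \<pi> i a"
abbreviation "U n \<equiv> {k. 1 \<le> k \<and> k \<le> p ^ (n + 1) - 1 \<and> \<not> p dvd k}"

text \<open>The weight of \<open>k\<close>. For \<open>k\<close> prime to \<open>p\<close>, the
  weights of its \<open>p\<close> lifts to the next level add up to it, so that \<open>w\<close> is
  a measure on the units.\<close>

definition w :: "nat \<Rightarrow> nat \<Rightarrow> 'a" where
  "w n k = a ^ k / (a ^ (p ^ (n + 1)) - 1) * \<omega> (int k) ^ i * inverse (\<omega> (int k))"

lemma w_OL: assumes "\<not> p dvd k" shows "w n k \<in> OL"
proof -
  have "inverse (a ^ (p ^ (n + 1)) - 1) \<in> OL" using a by (intro unit_OL a_power_notin_P) simp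
  then show ?thesis unfolding w_def divide_inverse
    using a teich_OL[OF assms] teich_inverse_Zp[OF assms] Zp_OL by simp
qed

lemma finite_U: "finite (U n)"
  by (rule finite_subset[of _ "{..p ^ (n + 1) - 1}"]) auto

lemma coef_eq: "coef n e = (\<Sum>k\<in>{k \<in> U n. idx n k = e}. w n k)"
  unfolding Mn_coeff_def w_def by (rule sum.cong) auto

lemma coef_OL: "coef n e \<in> OL"
  unfolding coef_eq by (rule OL_sum) (simp add: w_OL)

lemma Mn_fps_eq: "Mn_fps p OL \<pi> i a n = (\<Sum>k\<in>U n. fps_const (w n k) * (1 + fps_X) ^ idx n k)"
proof -
  have "Mn_fps p OL \<pi> i a n =
      (\<Sum>e<p ^ n. \<Sum>k\<in>{k \<in> U n. idx n k = e}. fps_const (w n k) * (1 + fps_X) ^ idx n k)"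
    unfolding Mn_fps_def coef_eq
  proof (rule sum.cong[OF refl])
    fix e
    have "fps_const (sum (w n) S) = (\<Sum>k\<in>S. fps_const (w n k))" for S
      by (induction S rule: infinite_finite_induct) (auto simp flip: fps_const_add)
    then show "fps_const (\<Sum>k\<in>{k \<in> U n. idx n k = e}. w n k) * (1 + fps_X) ^ e =
        (\<Sum>k\<in>{k \<in> U n. idx n k = e}. fps_const (w n k) * (1 + fps_X) ^ idx n k)"
      by (simp add: sum_distrib_right)
  qed
  also have "\<dots> = (\<Sum>k\<in>U n. fps_const (w n k) * (1 + fps_X) ^ idx n k)"
    using finite_U gamma_index_less by (intro sum.group) auto
  finally show ?thesis .
qed

lemma sum_U_Suc:
  fixes f :: "nat \<Rightarrow> 'b::comm_monoid_add"
  shows "(\<Sum>k\<in>U (Suc n). f k) = (\<Sum>k\<in>U n. \<Sum>j<p. f (k + j * p ^ (n + 1)))"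
proof -
  let ?q = "p ^ (n + 1)"
  have q: "?q > 0" "p dvd ?q" using p_gt by auto
  have U: "U m = {k. k < p ^ (m + 1) \<and> \<not> p dvd k}" for m
  proof -
    have "(1 \<le> k \<and> k \<le> r - 1 \<and> \<not> p dvd k) \<longleftrightarrow> (k < r \<and> \<not> p dvd k)" if "r > 0" for k r :: nat
      using that by (cases "k = 0") auto
    from this[of "p ^ (m + 1)"] show ?thesis using p_gt by simp
  qed
  have dvd: "p dvd k mod ?q \<longleftrightarrow> p dvd k" for k using q(2) by (rule dvd_mod_iff)
  have "(\<Sum>k\<in>U (Suc n). f k) = (\<Sum>(k, j)\<in>U n \<times> {..<p}. f (k + j * ?q))"
  proof (rule sum.reindex_bij_witness[of _ "\<lambda>(k, j). k + j * ?q" "\<lambda>k. (k mod ?q, k div ?q)"])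
    fix k assume "k \<in> U (Suc n)"
    then have k: "k < p * ?q" "\<not> p dvd k" unfolding U by simp_all
    then have "k div ?q < p" by (intro less_mult_imp_div_less)
    moreover have "k mod ?q < ?q" "\<not> p dvd k mod ?q" using q(1) dvd k(2) by simp_all
    ultimately show "(k mod ?q, k div ?q) \<in> U n \<times> {..<p}" unfolding U by blast
    show "(\<lambda>(k, j). k + j * ?q) (k mod ?q, k div ?q) = k"
      unfolding prod.case by (rule mod_div_mult_eq)
    show "(case (k mod ?q, k div ?q) of (k, j) \<Rightarrow> f (k + j * ?q)) = f k"
      unfolding prod.case by (simp only: mod_div_mult_eq)
  next
    fix x assume "x \<in> U n \<times> {..<p}"
    then obtain k j where x: "x = (k, j)" "k < ?q" "\<not> p dvd k" "j < p" unfolding U by auto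
    have "k + j * ?q < ?q + j * ?q" using x by simp
    also have "\<dots> = Suc j * ?q" by simp
    also have "\<dots> \<le> p * ?q" using x by (intro mult_right_mono) auto
    finally have "k + j * ?q < p ^ (Suc n + 1)" by simp
    moreover have "\<not> p dvd k + j * ?q" using x(3) q(2) by (metis dvd_add_left_iff dvd_mult)
    ultimately show "(\<lambda>(k, j). k + j * ?q) x \<in> U (Suc n)" unfolding U x(1) by simp
    have "(k + j * ?q) mod ?q = k" "(k + j * ?q) div ?q = j"
      using x(2) q(1) by simp_all
    then show "(((\<lambda>(k, j). k + j * ?q) x) mod ?q, ((\<lambda>(k, j). k + j * ?q) x) div ?q) = x"
      unfolding x(1) by (simp only: prod.case)
  qed
  then show ?thesis by (simp add: sum.cartesian_product)
qed

lemma Mn_compatible: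
  "\<exists>Q\<in>J 0. Mn_fps p OL \<pi> i a (Suc n) - Mn_fps p OL \<pi> i a n = Pn n * Q"
proof -
  let ?q = "p ^ (n + 1)"
  have kj: "[k = k + j * ?q] (mod p)" for k j
    by (rule cong_sym) (simp add: cong_add_lcancel_0_nat cong_0_iff)
  \<comment> \<open>All lifts share the Teichmueller factors, so this is a geometric sum in
    \<open>b\<close>, which trades the denominator \<open>b^p - 1\<close> for
    \<open>b - 1\<close>.\<close>
  have wsum: "(\<Sum>j<p. w (Suc n) (k + j * ?q)) = w n k" if k: "\<not> p dvd k" for k
  proof -
    define b where "b = a ^ ?q"
    have b: "b \<noteq> 1" "b ^ p \<noteq> 1" using a_power_neq_1[of "n + 1"] a_power_neq_1[of "Suc n + 1"]
      by (auto simp: b_def mult.commute simp flip: power_mult)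
    have "w (Suc n) (k + j * ?q) = a ^ k / (b ^ p - 1) * \<omega> (int k) ^ i * inverse (\<omega> (int k)) * b ^ j" for j
    proof -
      have "\<omega> (int (k + j * ?q)) = \<omega> (int k)" by (rule teich_cong_mod[OF k kj])
      moreover have "a ^ (p ^ (Suc n + 1)) = b ^ p" by (simp add: b_def mult_ac flip: power_mult)
      moreover have "a ^ (k + j * ?q) = a ^ k * b ^ j"
        by (simp add: b_def power_add mult.commute[of j] flip: power_mult)
      ultimately show ?thesis unfolding w_def by (simp only: divide_inverse mult_ac)
    qed
    then have "(\<Sum>j<p. w (Suc n) (k + j * ?q)) =
        a ^ k / (b ^ p - 1) * \<omega> (int k) ^ i * inverse (\<omega> (int k)) * (\<Sum>j<p. b ^ j)"
      by (simp add: sum_distrib_left)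
    also have "(\<Sum>j<p. b ^ j) = (b ^ p - 1) / (b - 1)" using b by (simp add: geometric_sum)
    finally show ?thesis using b unfolding w_def b_def[symmetric] by simp
  qed
  \<comment> \<open>The index of a lift agrees with \<open>idx n k\<close> modulo
    \<open>p^n\<close>, so the two powers of \<open>1 + T\<close> differ by a multiple of
    \<open>Pn n\<close>.\<close>
  have step: "\<exists>Q\<in>J 0. fps_const (w (Suc n) (k + j * ?q)) * (1 + fps_X) ^ idx (Suc n) (k + j * ?q) -
      fps_const (w (Suc n) (k + j * ?q)) * (1 + fps_X) ^ idx n k = Pn n * Q" if k: "\<not> p dvd k" for k j
  proof -
    let ?k = "k + j * ?q"
    have k': "\<not> p dvd ?k" using k by (simp add: dvd_add_left_iff)
    have t: "\<omega> (int ?k) = \<omega> (int k)" by (rule teich_cong_mod[OF k kj])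
    have "of_nat ((1 + p) ^ idx (Suc n) ?k) * \<omega> (int k) - of_nat ?k \<in> I (n + 1)"
      using gamma_index_cong[OF k', of "Suc n"] I_mono[of "n + 1" "Suc n + 1"] unfolding t by auto
    moreover have "of_nat ?k - of_nat k \<in> I (n + 1)"
      using mult_setI[of "of_nat j" OL "of_nat p ^ (n + 1)"] by (simp add: mult_ac)
    ultimately have "of_nat ((1 + p) ^ idx (Suc n) ?k) * \<omega> (int k) - of_nat k \<in> I (n + 1)"
      by (rule ms_trans)
    from gamma_index_unique[OF k this gamma_index_cong[OF k]]
    have "idx (Suc n) ?k mod p ^ n = idx n k"
      using gamma_index_less[OF k, of n] by (simp add: cong_def)
    then have e: "idx (Suc n) ?k = idx n k + p ^ n * (idx (Suc n) ?k div p ^ n)"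
      by (metis add.commute mult_div_mod_eq)
    define l where "l = idx (Suc n) ?k div p ^ n"
    define S where "S = (\<Sum>t<l. (1 + fps_X) ^ (p ^ n * t) :: 'a fps)"
    have PS: "(1 + fps_X) ^ (p ^ n * l) - 1 = Pn n * S"
      using power_diff_1_eq[of "(1 + fps_X) ^ (p ^ n) :: 'a fps" l] by (simp add: Pn_def S_def power_mult)
    have e': "idx (Suc n) ?k = idx n k + p ^ n * l" unfolding l_def by (rule e)
    have pw: "(1 + fps_X :: 'a fps) ^ idx (Suc n) ?k = (1 + fps_X) ^ idx n k * (1 + fps_X) ^ (p ^ n * l)"
      unfolding e' by (rule power_add)
    have factor: "c * (x * y) - c * x = s * (c * (t * x))" if "y - 1 = s * t" for c x y s t :: "'a fps"
      using arg_cong[OF that, of "\<lambda>r. c * x * r"] by (simp add: right_diff_distrib mult_ac)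
    have "fps_const (w (Suc n) ?k) * (1 + fps_X) ^ idx (Suc n) ?k -
      fps_const (w (Suc n) ?k) * (1 + fps_X) ^ idx n k = Pn n * (fps_const (w (Suc n) ?k) * (S * (1 + fps_X) ^ idx n k))"
      unfolding pw by (rule factor[OF PS])
    moreover have "S \<in> J 0" unfolding S_def by (intro J_sum) simp
    then have "fps_const (w (Suc n) ?k) * (S * (1 + fps_X) ^ idx n k) \<in> J 0" using w_OL[OF k'] by simp
    ultimately show ?thesis by (rule bexI)
  qed
  then obtain Q where Q: "\<And>k j. \<not> p dvd k \<Longrightarrow> Q k j \<in> J 0"
    "\<And>k j. \<not> p dvd k \<Longrightarrow> fps_const (w (Suc n) (k + j * ?q)) * (1 + fps_X) ^ idx (Suc n) (k + j * ?q) -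
      fps_const (w (Suc n) (k + j * ?q)) * (1 + fps_X) ^ idx n k = Pn n * Q k j" by metis
  have const: "fps_const (w n k) = (\<Sum>j<p. fps_const (w (Suc n) (k + j * ?q)))" if "\<not> p dvd k" for k
  proof -
    have "(\<Sum>j\<in>S. fps_const (f j)) = fps_const (sum f S)" for f :: "nat \<Rightarrow> 'a" and S
      by (induction S rule: infinite_finite_induct) auto
    then show ?thesis using wsum[OF that] by simp
  qed
  have "Mn_fps p OL \<pi> i a (Suc n) - Mn_fps p OL \<pi> i a n =
    (\<Sum>k\<in>U n. (\<Sum>j<p. fps_const (w (Suc n) (k + j * ?q)) * (1 + fps_X) ^ idx (Suc n) (k + j * ?q))
      - fps_const (w n k) * (1 + fps_X) ^ idx n k)"
    unfolding Mn_fps_eq sum_U_Suc sum_subtractf ..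
  also have "\<dots> = (\<Sum>k\<in>U n. \<Sum>j<p. Pn n * Q k j)"
    using const Q(2) by (intro sum.cong refl) (simp add: sum_distrib_right flip: sum_subtractf)
  also have "\<dots> = Pn n * (\<Sum>k\<in>U n. \<Sum>j<p. Q k j)" by (simp add: sum_distrib_left)
  finally have "Mn_fps p OL \<pi> i a (Suc n) - Mn_fps p OL \<pi> i a n = Pn n * (\<Sum>k\<in>U n. \<Sum>j<p. Q k j)" .
  moreover have "(\<Sum>k\<in>U n. \<Sum>j<p. Q k j) \<in> J 0"
    by (rule J_sum, rule J_sum, rule Q(1)) simp
  ultimately show ?thesis by (rule bexI)
qed

text \<open>Existence and uniqueness of the limit give the definite description its meaning; from
  here on only this expansion at one layer is used.\<close>

lemma iwasawa_M_layer:
  "\<exists>Q\<in>J 0. iwasawa_M p OL \<pi> i a = (\<Sum>e<p ^ n. fps_const (coef n e) * (1 + fps_X) ^ e) + Pn n * Q"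
proof -
  let ?f = "Mn_fps p OL \<pi> i a"
  have f: "?f n \<in> J 0" for n unfolding Mn_fps_eq by (intro J_sum J_0_mult) (auto simp: w_OL)
  have "\<exists>!M. (\<forall>j. fps_nth M j \<in> OL) \<and> (\<forall>n. \<exists>Q. (\<forall>j. fps_nth Q j \<in> OL) \<and>
          M - ?f n = ((1 + fps_X) ^ (p ^ n) - 1) * Q)"
    unfolding Pn_def[symmetric] J_0_iff[symmetric]
    using inverse_limit_exists[OF f Mn_compatible] inverse_limit_unique[of _ ?f] by (metis (no_types, lifting))
  from theI'[OF this] have "\<exists>Q. (\<forall>j. fps_nth Q j \<in> OL) \<and> iwasawa_M p OL \<pi> i a - ?f n = ((1 + fps_X) ^ (p ^ n) - 1) * Q"
    unfolding iwasawa_M_def by blast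
  then obtain Q where "Q \<in> J 0" "iwasawa_M p OL \<pi> i a - ?f n = Pn n * Q"
    unfolding Pn_def[symmetric] J_0_iff[symmetric] by blast
  then show "\<exists>Q\<in>J 0. iwasawa_M p OL \<pi> i a = (\<Sum>e<p ^ n. fps_const (coef n e) * (1 + fps_X) ^ e) + Pn n * Q"
    unfolding Mn_fps_def by (intro bexI[of _ Q]) (auto simp: algebra_simps)
qed

section \<open>Coefficients as sums over roots of unity; at \<open>h = \<omega>(k)\<close>,
  \<open>A h\<close> is \<open>\<theta>(k) / \<omega>(k)\<close>\<close>

definition A :: "'a \<Rightarrow> 'a" where "A h = h ^ i * inverse h"

text \<open>Representatives of the \<open>(p - 1)\<close>-th roots of unity modulo \<open>\<plusminus>1\<close>.\<close>
definition H :: "'a set" where "H = (\<lambda>l. \<omega> (int l)) ` {1..(p - 1) div 2}"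

text \<open>One step \<open>M t / h\<close> serves both \<open>h\<close> and \<open>-h\<close>,
  becoming an integer for each. The pair is kept together because \<open>-1\<close> is rational and
  could not be separated from 1.\<close>

definition G :: "'a \<Rightarrow> nat \<Rightarrow> 'a \<Rightarrow> 'a" where
  "G h N u = A h * a ^ res N (h * u) + A (- h) * a ^ res N (- (h * u))"

text \<open>A \<open>k\<close> contributes to \<open>e\<close> iff it is congruent to
  \<open>\<omega>(k) u\<close> modulo \<open>p^(n+1)\<close>, so each nonzero class \<open>l\<close>
  modulo \<open>p\<close> has exactly one such \<open>k\<close>, the representative of
  \<open>\<omega>(l) u\<close>. Admitting every \<open>p\<close>-adic \<open>u\<close> close to
  \<open>(1 + p)^e\<close> lets \<open>u\<close> be shifted later.\<close>

lemma coef_formula: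
  assumes u: "u \<in> Zp" and e: "e < p ^ n" and ue: "of_nat ((1 + p) ^ e) - u \<in> I (n + 1)"
  shows "coef n e * (a ^ (p ^ (n + 1)) - 1) = (\<Sum>h\<in>H. G h (n + 1) u)"
proof -
  let ?h = "\<lambda>l. A (\<omega> (int l)) * a ^ res (n + 1) (\<omega> (int l) * u)"
  have b: "a ^ (p ^ (n + 1)) - 1 \<noteq> 0" using a_power_neq_1[of "n + 1"] by simp
  have "[(1 + p) ^ e = 1 ^ e] (mod p)"
    by (intro cong_pow) (subst cong_add_lcancel_0_nat, simp add: cong_0_iff)
  then have "of_int (int ((1 + p) ^ e) - 1) \<in> P" unfolding of_int_P_iff
    by (metis cong_iff_dvd_diff cong_int_iff of_nat_1 power_one)
  then have "of_nat ((1 + p) ^ e) - 1 \<in> P" by simp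
  moreover have "of_nat ((1 + p) ^ e) - u \<in> P" using ue I_P[of "n + 1"] by auto
  \<comment> \<open>Hence \<open>\<omega>(l) u\<close> reduces to \<open>l\<close>, and
    \<open>k mod p\<close> recovers the class.\<close>
  ultimately have uP: "u - 1 \<in> P" using ms_diff[of "of_nat ((1 + p) ^ e) - 1" \<pi>] by fastforce
  have nd: "\<not> p dvd l" if "l \<in> {1..<p}" for l using that by (auto simp: nat_dvd_not_less)
  have "coef n e * (a ^ (p ^ (n + 1)) - 1) = (\<Sum>k\<in>{k \<in> U n. idx n k = e}. A (\<omega> (int k)) * a ^ k)"
    unfolding coef_eq sum_distrib_right
  proof (rule sum.cong[OF refl])
    have "x / B * s * t * B = s * t * x" if "B \<noteq> 0" for x B s t :: 'a using that by simp
    from this[OF b] show "w n k * (a ^ (p ^ (n + 1)) - 1) = A (\<omega> (int k)) * a ^ k" for k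
      unfolding w_def A_def .
  qed
  also have "\<dots> = (\<Sum>l\<in>{1..<p}. ?h l)"
  proof (rule sum.reindex_bij_witness[of _ "\<lambda>l. res (n + 1) (\<omega> (int l) * u)" "\<lambda>k. k mod p"])
    fix k assume "k \<in> {k \<in> U n. idx n k = e}"
    then have k: "1 \<le> k" "k \<le> p ^ (n + 1) - 1" "\<not> p dvd k" "idx n k = e" by auto
    have kp: "k < p ^ (n + 1)" using k(1,2) by linarith
    show "k mod p \<in> {1..<p}" using k(3) p_gt by (auto simp: dvd_eq_mod_eq_0 Suc_le_eq)
    have t: "\<omega> (int (k mod p)) = \<omega> (int k)" by (rule teich_cong_mod[OF k(3)]) (simp add: cong_def)
    have "\<omega> (int k) * u - \<omega> (int k) * of_nat ((1 + p) ^ e) \<in> I (n + 1)"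
      using ms_multL[OF teich_OL[OF k(3)] ms_minus[OF ue]] by (simp add: algebra_simps)
    moreover have "\<omega> (int k) * of_nat ((1 + p) ^ e) - of_nat k \<in> I (n + 1)"
      using gamma_index_cong[OF k(3), of n] unfolding k(4) by (simp add: mult.commute)
    ultimately have "\<omega> (int k) * u - of_nat k \<in> I (n + 1)" by (rule ms_trans)
    then have r: "res (n + 1) (\<omega> (int k) * u) = k" using kp by (intro res_eqI)
    show "res (n + 1) (\<omega> (int (k mod p)) * u) = k" unfolding t by (rule r)
    show "?h (k mod p) = A (\<omega> (int k)) * a ^ k" unfolding t r ..
  next
    fix l assume l: "l \<in> {1..<p}"
    define k where "k = res (n + 1) (\<omega> (int l) * u)"
    have wu: "\<omega> (int l) * u \<in> Zp" using teich_Zp[OF nd[OF l]] u by simp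
    have k: "k < p ^ (n + 1)" "\<omega> (int l) * u - of_nat k \<in> I (n + 1)"
      unfolding k_def using res_less[OF wu] res_cong[OF wu] by blast+
    have "\<omega> (int l) * u - of_nat k \<in> P" using k(2) I_P[of "n + 1"] by auto
    moreover have "\<omega> (int l) - \<omega> (int l) * u \<in> P"
      using ms_multL[OF teich_OL[OF nd[OF l]] ms_minus[OF uP]] by (simp add: algebra_simps)
    ultimately have lk: "\<omega> (int l) - of_nat k \<in> P" by (metis ms_trans)
    then have "of_nat l - of_nat k \<in> P" using ms_diff[OF lk teich_cong[OF nd[OF l]]] ms_diff by simp
    then have "of_int (int l - int k) \<in> P" by simp
    then have c: "[l = k] (mod p)" unfolding of_int_P_iff by (metis cong_iff_dvd_diff cong_int_iff)
    then show "res (n + 1) (\<omega> (int l) * u) mod p = l" using l unfolding k_def[symmetric] cong_def by simp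
    have kd: "\<not> p dvd k" using c nd[OF l] cong_dvd_iff by blast
    have t: "\<omega> (int k) = \<omega> (int l)" by (rule teich_cong_mod[OF nd[OF l] c])
    have "of_nat ((1 + p) ^ e) * \<omega> (int l) - u * \<omega> (int l) \<in> I (n + 1)"
      using ms_multR[OF ue teich_OL[OF nd[OF l]]] by (simp add: algebra_simps)
    then have "of_nat ((1 + p) ^ e) * \<omega> (int k) - of_nat k \<in> I (n + 1)"
      using k(2) unfolding t by (metis ms_trans mult.commute)
    then have "idx n k = e" by (rule gamma_index_eqI[OF kd e])
    moreover have "1 \<le> k" using kd by (cases k) auto
    moreover have "k \<le> p ^ (n + 1) - 1" using k(1) by linarith
    ultimately show "res (n + 1) (\<omega> (int l) * u) \<in> {k \<in> U n. idx n k = e}"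
      unfolding k_def[symmetric] using kd by blast
  qed
  also have "\<dots> = (\<Sum>l\<in>{1..(p - 1) div 2}. ?h l) + (\<Sum>l\<in>{(p - 1) div 2 <..<p}. ?h l)"
    by (subst sum.union_disjoint[symmetric]) (auto intro!: sum.cong)
  \<comment> \<open>The upper half of the classes is the negative of the lower half.\<close>
  also have "(\<Sum>l\<in>{(p - 1) div 2 <..<p}. ?h l) = (\<Sum>l\<in>{1..(p - 1) div 2}. ?h (p - l))"
  proof -
    have "odd p" by (rule p_odd)
    then obtain q where "p = 2 * q + 1" by (auto elim: oddE)
    then show ?thesis by (intro sum.reindex_bij_witness[of _ "\<lambda>l. p - l" "\<lambda>l. p - l"]) auto
  qed
  also have "(\<Sum>l\<in>{1..(p - 1) div 2}. ?h l) + \<dots> = (\<Sum>l\<in>{1..(p - 1) div 2}. G (\<omega> (int l)) (n + 1) u)"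
    unfolding sum.distrib[symmetric]
  proof (rule sum.cong[OF refl])
    fix l assume "l \<in> {1..(p - 1) div 2}"
    then have "\<omega> (int (p - l)) = - \<omega> (int l)" by (intro teich_minus) auto
    then show "?h l + ?h (p - l) = G (\<omega> (int l)) (n + 1) u" by (simp only: G_def mult_minus_left)
  qed
  also have "\<dots> = (\<Sum>h\<in>H. G h (n + 1) u)"
    unfolding H_def
  proof (subst sum.reindex)
    show "inj_on (\<lambda>l. \<omega> (int l)) {1..(p - 1) div 2}"
    proof (rule inj_onI)
      fix k l assume "k \<in> {1..(p - 1) div 2}" "l \<in> {1..(p - 1) div 2}" "\<omega> (int k) = \<omega> (int l)"
      moreover from this have "k \<in> {1..<p}" "l \<in> {1..<p}" by auto
      ultimately show "k = l" using teich_inj[of k l] nd by (auto simp: cong_less_modulus_unique_nat)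
    qed
  qed simp
  finally show ?thesis .
qed

lemma H_props:
  shows finite_H: "finite H" and one_in_H: "1 \<in> H"
    and H_Zp: "h \<in> H \<Longrightarrow> h \<in> Zp \<and> inverse h \<in> Zp \<and> h \<noteq> 0"
    and H_notin_P: "h \<in> H \<Longrightarrow> h \<notin> P"
    and H_irrational: "h \<in> H - {1} \<Longrightarrow> of_int x * h = of_int y \<Longrightarrow> x = 0"
proof -
  show "finite H" by (simp add: H_def)
  show "1 \<in> H" unfolding H_def using p_ge teich_1 by (intro image_eqI[of _ _ 1]) auto
  have H: "\<exists>l. h = \<omega> (int l) \<and> \<not> p dvd l \<and> 0 < l \<and> l < p - 1" if h: "h \<in> H" for h
  proof -
    obtain l where "h = \<omega> (int l)" "1 \<le> l" "l \<le> (p - 1) div 2" using h by (auto simp: H_def)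
    moreover from this have "0 < l" "l < p - 1" using p_ge by linarith+
    moreover from this have "\<not> p dvd l" by (intro nat_dvd_not_less) linarith+
    ultimately show ?thesis by blast
  qed
  show "h \<in> Zp \<and> inverse h \<in> Zp \<and> h \<noteq> 0" if "h \<in> H"
    using H[OF that] teich_Zp teich_inverse_Zp teich_nonzero by auto
  show "h \<notin> P" if "h \<in> H"
    using H[OF that] root_of_unity_notin_P[OF teich_power] by auto
  show "x = 0" if h: "h \<in> H - {1}" and xy: "of_int x * h = of_int y"
  proof (rule ccontr)
    assume x: "x \<noteq> 0"
    from H[of h] h obtain l where l: "h = \<omega> (int l)" "\<not> p dvd l" "l < p - 1" by blast
    \<comment> \<open>Raising to the power \<open>p - 1\<close> removes \<open>h\<close>, so
      \<open>\<bar>x\<bar> = \<bar>y\<bar>\<close> and \<open>h\<close> is 1 or -1.\<close>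
    have "(of_int x * h) ^ (p - 1) = of_int (y ^ (p - 1))" unfolding xy by simp
    then have "of_int (x ^ (p - 1)) = (of_int (y ^ (p - 1)) :: 'a)"
      using teich_power[OF l(2)] l(1) by (simp add: power_mult_distrib)
    then have "x ^ (p - 1) = y ^ (p - 1)" unfolding of_int_eq_iff .
    then have "\<bar>x\<bar> ^ (p - 1) = \<bar>y\<bar> ^ (p - 1)" by (metis power_abs)
    then have "\<bar>x\<bar> = \<bar>y\<bar>" using power_eq_imp_eq_base[of "\<bar>x\<bar>" "p - 1" "\<bar>y\<bar>"] p_gt by simp
    then have "y = x \<or> y = - x" by linarith
    then have "h = 1 \<or> h = -1"
    proof
      assume "y = - x"
      then have "of_int x * h = of_int x * (-1)" using xy by simp
      moreover have "of_int x \<noteq> (0::'a)" using x by simp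
      ultimately show ?thesis unfolding mult_cancel_left by blast
    qed (use xy x in simp)
    then have "h = -1" using h by simp
    \<comment> \<open>-1 belongs to the class \<open>p - 1\<close>, beyond the range used for
      \<open>H\<close>.\<close>
    also have "-1 = \<omega> (int (p - 1))" using teich_minus[of 1] teich_1 p_gt by simp
    finally have "\<omega> (int l) = \<omega> (int (p - 1))" using l(1) by simp
    then have "[l = p - 1] (mod p)" using p_gt l by (intro teich_inj) (auto simp: nat_dvd_not_less)
    from cong_less_modulus_unique_nat[OF this] show False using l(3) p_gt by simp
  qed
qed

lemma A_OL: "h \<in> Zp \<Longrightarrow> inverse h \<in> Zp \<Longrightarrow> A h \<in> OL \<and> A (- h) \<in> OL"
  by (simp add: A_def Zp_OL)

section \<open>The case \<open>a = -1\<close> modulo \<open>\<pi>\<close> with \<open>i\<close>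
  odd\<close>

lemma coef_P_if_odd:
  assumes "a + 1 \<in> P" "odd i" "e < p ^ n" shows "coef n e \<in> P"
proof -
  let ?N = "n + 1" and ?u = "of_nat ((1 + p) ^ e) :: 'a"
  have p1: "\<not> p dvd (1 + p) ^ e" using prime prime_dvd_power[of p "1 + p" e] p_gt
    by (metis dvd_add_left_iff dvd_refl nat_dvd_1_iff_1 less_numeral_extra(4))
  have "G h ?N ?u \<in> P" if h: "h \<in> H" for h
  proof -
    define r where "r = res ?N (h * ?u)"
    have Z: "h * ?u \<in> Zp" using H_Zp[OF h] Zp_of_nat Zp_mult by blast
    have "h * ?u \<notin> P"
    proof
      assume "h * ?u \<in> P"
      then have "h \<in> P \<or> ?u \<in> P" using H_Zp[OF h] Zp_OL OL_of_nat by (intro P_prime) auto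
      then show False using H_notin_P[OF h] p1 of_nat_P_iff by blast
    qed
    then have r0: "r \<noteq> 0" unfolding r_def using res_eq_0_iff[OF Z] I_P[of ?N] by auto
    have r: "r < p ^ ?N" using res_less[OF Z] unfolding r_def .
    have m: "res ?N (- (h * ?u)) = p ^ ?N - r" using res_minus[OF Z] r0 unfolding r_def by blast
    have "A (- h) = A h" using assms(2) by (simp add: A_def)
    then have "G h ?N ?u = A h * (a ^ r + a ^ (p ^ ?N - r))"
      unfolding G_def m r_def[symmetric] by (simp add: algebra_simps)
    moreover have "a ^ r + a ^ (p ^ ?N - r) \<in> P"
    proof -
      have c: "a ^ k - (-1) ^ k \<in> P" for k using ms_power_cong[of a "-1" \<pi> k] assms(1) a by simp
      have "odd (p ^ ?N)" using p_odd by simp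
      \<comment> \<open>The exponents \<open>r\<close> and \<open>p ^ ?N - r\<close> have opposite
        parity.\<close>
      then have "(-1) ^ r + (-1) ^ (p ^ ?N - r) = (0::'a)" using r by (cases "even r") auto
      then show ?thesis using ms_add[OF c[of r] c[of "p ^ ?N - r"]] by (simp add: algebra_simps)
    qed
    ultimately show ?thesis using A_OL[of h] H_Zp[OF h] by (simp add: ms_multL)
  qed
  moreover have "coef n e * (a ^ (p ^ ?N) - 1) = (\<Sum>h\<in>H. G h ?N ?u)"
    using Zp_of_nat assms(3) by (intro coef_formula) (simp_all del: of_nat_power)
  ultimately have "coef n e * (a ^ (p ^ ?N) - 1) \<in> P" using ms_sum by metis
  then show ?thesis using P_prime[OF coef_OL] a a_power_notin_P[of ?N] by (metis OL_1 OL_diff OL_power)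
qed

text \<open>All coefficients of all layers vanish modulo \<open>\<pi>\<close>, hence so does the
  whole series. Coefficient \<open>j\<close> of the derivative comes from coefficient
  \<open>Suc j\<close>, which layer \<open>Suc j\<close> determines modulo
  \<open>\<pi>\<close>.\<close>

lemma deriv_P_if_odd:
  assumes "a + 1 \<in> P" "odd i" shows "fps_deriv (iwasawa_M p OL \<pi> i a) $ j \<in> P"
proof -
  let ?M = "iwasawa_M p OL \<pi> i a"
  obtain Q where Q: "Q \<in> J 0"
    "?M = (\<Sum>e<p ^ Suc j. fps_const (coef (Suc j) e) * (1 + fps_X) ^ e) + Pn (Suc j) * Q"
    using iwasawa_M_layer[of "Suc j"] by blast
  have "Suc j < p ^ Suc j" using p_gt by (intro power_gt_expt) auto
  with coeff_P_imp_P[OF Q coef_P_if_odd[OF assms]] have "?M $ Suc j \<in> P" by blast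
  then show ?thesis by (simp add: ms_multL del: of_nat_Suc)
qed

section \<open>The converse\<close>

lemma sum_G_P:
  assumes D: "\<And>j. fps_deriv (iwasawa_M p OL \<pi> i a) $ j \<in> P"
    and N: "N \<ge> 2" and u: "u \<in> Zp" "u - 1 \<in> I 1" "u - 1 \<notin> I 2"
  shows "(\<Sum>h\<in>H. G h N u) \<in> P"
proof -
  define n where "n = N - 1"
  have n: "N = n + 1" "n > 0" using N by (auto simp: n_def)
  obtain c :: int where c: "u - of_int c \<in> I (n + 1)" using u(1) by (rule Zp_approx)
  have "u - of_int c \<in> I 1" using c I_mono[of 1 "n + 1"] by auto
  then have "of_int (c - 1) \<in> I 1" using ms_diff[OF u(2)] by fastforce
  then have "int p dvd c - 1" unfolding of_int_I_iff by simp
  from one_plus_prime_surj[OF prime p_odd this, of n] obtain e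
    where e: "e < p ^ n" "int p ^ (n + 1) dvd (1 + int p) ^ e - c" by blast
  have "of_int ((1 + int p) ^ e - c) \<in> I (n + 1)" unfolding of_int_I_iff by (rule e(2))
  then have "of_nat ((1 + p) ^ e) - of_int c \<in> I (n + 1)" by simp
  then have ue: "of_nat ((1 + p) ^ e) - u \<in> I (n + 1)"
    using c ms_trans[of "of_nat ((1 + p) ^ e)" "of_int c"] ms_commute by metis
  \<comment> \<open>Here \<open>u - 1 \<notin> I 2\<close> enters: \<open>(1 + p)^e\<close> is
    congruent to 1 modulo \<open>p^2\<close> exactly when \<open>p\<close> divides
    \<open>e\<close>.\<close>
  have "\<not> p dvd e"
  proof
    assume "p dvd e"
    then have "of_nat ((1 + p) ^ e) - of_nat ((1 + p) ^ 0) \<in> I (1 + 1)"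
      unfolding one_plus_p_cong_iff by (simp add: cong_0_iff)
    moreover have "of_nat ((1 + p) ^ e) - u \<in> I (1 + 1)" using ue n I_mono[of "1 + 1" "n + 1"] by auto
    ultimately have "u - of_nat ((1 + p) ^ 0) \<in> I (1 + 1)" using ms_trans ms_commute by metis
    then show False using u(3) by (simp add: numeral_2_eq_2)
  qed
  obtain Q where Q: "Q \<in> J 0"
    "iwasawa_M p OL \<pi> i a = (\<Sum>e<p ^ n. fps_const (coef n e) * (1 + fps_X) ^ e) + Pn n * Q"
    using iwasawa_M_layer by blast
  have "coef n e \<in> P" by (rule deriv_P_imp_coeff_P[OF coef_OL n(2) Q D e(1) \<open>\<not> p dvd e\<close>])
  then have "coef n e * (a ^ (p ^ (n + 1)) - 1) \<in> P" using a by (intro ms_multR) auto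
  then show ?thesis unfolding coef_formula[OF u(1) e(1) ue] n(1) .
qed

lemma deriv_P_imp_odd:
  assumes D: "\<And>j. fps_deriv (iwasawa_M p OL \<pi> i a) $ j \<in> P"
  shows "a + 1 \<in> P \<and> odd i"
proof -
  obtain m where m: "m > 0" "a ^ m - 1 \<in> P" using power_eq_one_residue[OF a a_notin_P] by blast
  \<comment> \<open>The factor \<open>m\<close> makes \<open>a^M\<close> congruent to 1; the factor
    \<open>p^2\<close> keeps \<open>?good\<close> stable under shifts by multiples of
    \<open>M\<close>.\<close>
  define M where "M = p ^ 2 * m"
  have M: "M > 0" using m(1) p_gt by (simp add: M_def)
  have pow_M: "a ^ c - 1 \<in> P" if "m dvd c" for c
    using ms_power_cong[OF m(2), of "c div m"] a that by (simp flip: power_mult)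
  let ?good = "\<lambda>u. u - 1 \<in> I 1 \<and> u - 1 \<notin> I 2"
  have good: "?good (u + of_nat M * v)" if "?good u" "v \<in> Zp" for u v
  proof -
    have 2: "of_nat M * v \<in> I 2"
      using mult_setI[of "of_nat m * v" OL "of_nat p ^ 2"] Zp_OL[OF that(2)] by (simp add: M_def mult.assoc)
    then have 1: "of_nat M * v \<in> I 1" using I_mono[of 1 2] by auto
    have e: "u + of_nat M * v - 1 = (u - 1) + of_nat M * v" by simp
    show ?thesis unfolding e using that(1) ms_add[OF _ 1] ms_diff[OF _ 2] by fastforce
  qed
  have "\<exists>Z. \<forall>z\<ge>Z. ?good (- of_nat z) \<longrightarrow> (\<exists>N c. z < c \<and> c < p ^ N \<and> M dvd c \<and>
     (A 1 * a ^ res N (1 * - of_nat z) + A (- 1) * a ^ res N (- (1 * - of_nat z))) -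
     (A 1 * a ^ res N (1 * (- of_nat z + of_nat c)) + A (- 1) * a ^ res N (- (1 * (- of_nat z + of_nat c)))) \<in> P)"
  proof (rule isolate_jump[where good = ?good and B = "\<lambda>h. A (- h)" and K = 2])
    show "a ^ M - 1 \<in> P" by (rule pow_M) (simp add: M_def)
    show "(\<Sum>h\<in>H. A h * a ^ res N (h * u) + A (- h) * a ^ res N (- (h * u))) \<in> P"
      if "2 \<le> N" "u \<in> Zp" "?good u" for N u
      using sum_G_P[OF D that(1,2)] that(3) unfolding G_def by blast
  qed (use finite_H one_in_H H_Zp H_irrational A_OL a M good in blast)+
  then obtain Z where Z: "\<And>z. z \<ge> Z \<Longrightarrow> ?good (- of_nat z) \<Longrightarrow> \<exists>N c. z < c \<and> c < p ^ N \<and> M dvd c \<and>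
     (A 1 * a ^ res N (- of_nat z) + A (- 1) * a ^ res N (of_nat z)) -
     (A 1 * a ^ res N (- of_nat z + of_nat c) + A (- 1) * a ^ res N (- (- of_nat z + of_nat c))) \<in> P"
    by auto
  define b where "b = A (- 1)"
  have b: "b = - ((-1) ^ i)" "b \<in> OL" by (auto simp: b_def A_def)
  have key: "1 - b * a ^ (2 * z) \<in> P" if z: "z \<ge> Z" "z > 0" "?good (- of_nat z)" for z
  proof -
    obtain N c where Nc: "z < c" "c < p ^ N" "M dvd c"
      "(A 1 * a ^ res N (- of_nat z) + A (- 1) * a ^ res N (of_nat z)) -
       (A 1 * a ^ res N (- of_nat z + of_nat c) + A (- 1) * a ^ res N (- (- of_nat z + of_nat c))) \<in> P"
      using Z[OF z(1,3)] by blast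
    have A1: "A 1 = 1" by (simp add: A_def)
    have "a ^ c - 1 \<in> P" using Nc(3) by (intro pow_M) (auto simp: M_def)
    then show ?thesis using jump_at_one[OF a a1_notin_P Nc(1,2) _ z(2) _ b(2)] Nc(4)
      unfolding A1 b_def by simp
  qed
  \<comment> \<open>For these arguments \<open>- z - 1\<close> is \<open>- p * (l + p * j)\<close>,
    divisible by \<open>p\<close> exactly once.\<close>
  have good_z: "?good (- of_nat (l * p - 1 + p ^ 2 * j))" if l: "1 \<le> l" "\<not> p dvd l" for l j
  proof -
    have "0 < l * p" using l p_gt by simp
    then obtain r where r: "l * p = Suc r" using gr0_implies_Suc by blast
    have r': "int p * int l = int r + 1" using arg_cong[OF r, of int] by (simp add: mult.commute)
    have e: "- of_nat (l * p - 1 + p ^ 2 * j) - 1 = (of_int (- (int p * (int l + int p * int j))) :: 'a)"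
      unfolding r distrib_left r' by (simp add: power2_eq_square)
    have "\<not> int p dvd int l + int p * int j" using l(2) by (simp add: dvd_add_left_iff)
    then have "\<not> int p ^ 2 dvd - (int p * (int l + int p * int j))" using p_gt by (simp add: power2_eq_square)
    then show ?thesis unfolding e of_int_I_iff by simp
  qed
  \<comment> \<open>The choices \<open>l = 1\<close> and \<open>l = 2\<close> give two admissible
    values that differ by \<open>p\<close>; \<open>j = Z\<close> makes them large enough.\<close>
  define z where "z = 1 * p - 1 + p ^ 2 * Z"
  have "1 * Z \<le> p ^ 2 * Z" using p_gt by (intro mult_right_mono) auto
  then have zZ: "z \<ge> Z" "z > 0" unfolding z_def using p_gt by linarith+
  have zp: "z + p = 2 * p - 1 + p ^ 2 * Z" using p_gt by (simp add: z_def)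
  have nd: "\<not> p dvd 1" "\<not> p dvd 2" using p_ge by (auto dest: dvd_imp_le)
  have k1: "1 - b * a ^ (2 * z) \<in> P" using key[OF zZ] good_z[OF _ nd(1)] unfolding z_def by blast
  have k2: "1 - b * a ^ (2 * (z + p)) \<in> P"
  proof (rule key)
    show "?good (- of_nat (z + p))" unfolding zp using good_z[OF _ nd(2)] by simp
  qed (use zZ in auto)
  define y where "y = b * a ^ (2 * z)"
  have y: "y \<in> OL" "1 - y \<in> P" using b a k1 by (auto simp: y_def)
  have yP: "y \<notin> P"
  proof
    assume "y \<in> P"
    from ms_add[OF y(2) this] show False using one_notin_P by simp
  qed
  \<comment> \<open>Subtracting the two relations leaves a unit times \<open>a^(2 * p) - 1\<close>,
    and \<open>frobenius_P\<close> reduces this to \<open>a^2 = 1\<close> in the residue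
    field.\<close>
  have "(1 - y) - (1 - b * a ^ (2 * (z + p))) = y * ((a ^ 2) ^ (p ^ 1) - 1)"
    by (simp add: y_def power_add algebra_simps flip: power_mult)
  then have "y * ((a ^ 2) ^ (p ^ 1) - 1) \<in> P" using ms_diff[OF y(2) k2] by simp
  then have "(a ^ 2) ^ (p ^ 1) - 1 \<in> P" using P_prime[OF y(1)] yP a by (metis OL_1 OL_diff OL_power)
  then have a2: "a ^ 2 - 1 \<in> P" using frobenius_P[of "a ^ 2" 1] a by simp
  have "a ^ 2 - 1 = (a - 1) * (a + 1)" by (simp add: power2_eq_square algebra_simps)
  then have "a + 1 \<in> P" using a2 P_prime[of "a - 1" "a + 1"] a a1_notin_P by auto
  moreover have "odd i"
  proof
    assume "even i"
    \<comment> \<open>For even \<open>i\<close>, \<open>b = -1\<close>; with \<open>a^2\<close>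
      congruent to 1 this makes \<open>1 - y\<close> congruent to 2, a unit.\<close>
    then have "y = - (a ^ (2 * z))" by (simp add: y_def b(1))
    moreover have "a ^ (2 * z) - 1 \<in> P" using ms_power_cong[OF a2, of z] a by (simp add: power_mult)
    ultimately have "of_nat 2 \<in> P" using ms_diff[OF y(2), of "a ^ (2 * z) - 1"] by simp
    then show False using nd(2) of_nat_P_iff by blast
  qed
  ultimately show ?thesis by simp
qed

end

theorem theorem3p3:
  fixes p :: nat and OL :: "'a::field_char_0 set" and \<pi> a :: 'a and i :: nat
  assumes "prime p" and "p \<ge> 5"
    and "padic_field p OL \<pi>"
    and "i < p - 1"
    and "a \<in> OL" and "a * (a - 1) \<notin> mult_set \<pi> OL"
  shows "(\<forall>j. fps_nth (fps_deriv (iwasawa_M p OL \<pi> i a)) j \<in> mult_set \<pi> OL) \<longleftrightarrow>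
         (a - (-1) \<in> mult_set \<pi> OL \<and> teich p OL \<pi> (-1) ^ i = -1)"
proof -
  interpret padic_measure p OL \<pi> a i
    using assms by unfold_locales
  \<comment> \<open>Since \<open>\<theta>(-1) = \<omega>(-1)^i = (-1)^i\<close>, the parity of
    \<open>\<theta>\<close> is that of \<open>i\<close>.\<close>
  have "(-1) ^ i = (-1 :: 'a) \<longleftrightarrow> odd i" by (cases "even i") auto
  then show ?thesis using deriv_P_imp_odd deriv_P_if_odd unfolding teich_minus_1 by auto
qed

end
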